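(* Assume that the constitutive coefficients satisfy $\mu>0$, $\mu_{\rm c}>0$, $2\lambda+\mu>0$, $b_1>0$, $b_2>0$, $b_3>0$. Let $c_2^+$ denote the smallest eigenvalue of the quadratic form $W_{\mathrm{curv}}(S)$, and let $c_1^+$ and $C_1^+>0$ denote the smallest and the largest eigenvalues of the quadratic form $W_{\mathrm{shell}}(S)$ (quadratic forms on $\mathbb{R}^{3\times3}$ with the Frobenius norm). If the thickness $h>0$ satisfies one of the following conditions (on $\omega$, with $\kappa_1,\kappa_2$ the principal curvatures of $y_0(\omega)$): i) $h|\kappa_1|<\frac12$, $h|\kappa_2|<\frac12$ and $h^2<\left(\frac{47}{4}\right)^2(5-2\sqrt6)\,\frac{c_2^+}{C_1^+}$; ii) $h|\kappa_1|<\frac1a$, $h|\kappa_2|<\frac1a$ with $a>\max\Big\{1+\frac{\sqrt2}{2},\ \frac{1+\sqrt{1+3\frac{C_1^+}{c_1^+}}}{2}\Big\}$; then $W^{(h^3)}(\mathcal{E}_{m,s},\mathcal{K}_{e,s})$ is coercive in the sense that there exists a constant $a_1^+>0$, depending on the constitutive coefficients, such that $$W^{(h^3)}(\mathcal{E}_{m,s},\mathcal{K}_{e,s})\ \ge\ a_1^+\big(\lVert\mathcal{E}_{m,s}\rVert^2+\lVert\mathcal{K}_{e,s}\rVert^2\big)$$ for the strain and curvature tensors $\mathcal{E}_{m,s},\mathcal{K}_{e,s}$ of any midsurface deformation $m$ and microrotation $\overline{Q}_{e,s}$.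
   Context: Notation: $\langle X,Y\rangle=\mathrm{tr}(XY^T)$ and $\lVert X\rVert^2=\langle X,X\rangle$ (Frobenius); $\mathrm{sym}\,X=\frac12(X+X^T)$, $\mathrm{skew}\,X=\frac12(X-X^T)$, $\mathrm{dev}\,X=X-\frac13\mathrm{tr}(X)\,\mathbb{1}_3$ for $X\in\mathbb{R}^{3\times3}$, with $\mathbb 1_3$ the identity. $(A_1|A_2|A_3)$ is the matrix with columns $A_1,A_2,A_3$; for a $3\times 2$ matrix $M$ and a vector $v$, $(M|v)$ is the $3\times3$ matrix obtained by appending the column $v$. For skew-symmetric $A\in\mathfrak{so}(3)$, $\mathrm{axl}\,A=(-A_{23},A_{13},-A_{12})^T$. Geometry: $\omega\subset\mathbb{R}^2$ is a bounded domain with Lipschitz boundary, $h>0$ is the constant thickness, $y_0:\omega\to\mathbb{R}^3$ is a $C^2$ map parametrizing the midsurface of the curved reference configuration, $n_0=\frac{\partial_{x_1}y_0\times\partial_{x_2}y_0}{\lVert\partial_{x_1}y_0\times\partial_{x_2}y_0\rVert}$, and $\Theta(x_1,x_2,x_3)=y_0(x_1,x_2)+x_3\,n_0(x_1,x_2)$ is assumed to be a $C^1$-diffeomorphism from $\Omega_h=\omega\times(-\frac h2,\frac h2)$ onto its image. Then $\nabla_x\Theta(0)=(\nabla y_0|n_0)$ (value at $x_3=0$). Put $\mathrm{I}_{y_0}=(\nabla y_0)^T\nabla y_0$, $\mathrm{II}_{y_0}=-(\nabla y_0)^T\nabla n_0$, $\mathrm{L}_{y_0}=\mathrm{I}_{y_0}^{-1}\mathrm{II}_{y_0}$,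 $\mathrm{K}=\det\mathrm{L}_{y_0}$ (Gauss curvature), $\mathrm{H}=\frac12\mathrm{tr}\,\mathrm{L}_{y_0}$ (mean curvature); $\kappa_1,\kappa_2$ are the eigenvalues of $\mathrm{L}_{y_0}$. Define $$\mathrm{B}_{y_0}=-(\nabla n_0|0)[\nabla_x\Theta(0)]^{-1},\qquad \mathrm{C}_{y_0}=\det(\nabla_x\Theta(0))\,[\nabla_x\Theta(0)]^{-T}\begin{pmatrix}0&1&0\\-1&0&0\\0&0&0\end{pmatrix}[\nabla_x\Theta(0)]^{-1}.$$ Strain measures: for $m:\omega\to\mathbb{R}^3$ and $\overline{Q}_{e,s}:\omega\to\mathrm{SO}(3)$, $$\mathcal{E}_{m,s}=\overline{Q}_{e,s}^T(\nabla m\,|\,\overline{Q}_{e,s}\nabla_x\Theta(0)e_3)[\nabla_x\Theta(0)]^{-1}-\mathbb{1}_3,$$ $$\mathcal{K}_{e,s}=(\mathrm{axl}(\overline{Q}_{e,s}^T\partial_{x_1}\overline{Q}_{e,s})\,|\,\mathrm{axl}(\overline{Q}_{e,s}^T\partial_{x_2}\overline{Q}_{e,s})\,|\,0)[\nabla_x\Theta(0)]^{-1}.$$ Energy (pointwise on $\omega$): with $\mathcal E=\mathcal{E}_{m,s}$, $\mathcal K=\mathcal{K}_{e,s}$, $$\begin{aligned}W^{(h^3)}(\mathcal E,\mathcal K)=&\Big(h+\mathrm K\tfrac{h^3}{12}\Big)W_{\mathrm{shell}}(\mathcal E)+\tfrac{h^3}{12}W_{\mathrm{shell}}(\mathcal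 E\mathrm B_{y_0}+\mathrm C_{y_0}\mathcal K)-\tfrac{h^3}{3}\mathrm H\,\mathcal W_{\mathrm{shell}}(\mathcal E,\mathcal E\mathrm B_{y_0}+\mathrm C_{y_0}\mathcal K)\\&+\tfrac{h^3}{6}\mathcal W_{\mathrm{shell}}(\mathcal E,(\mathcal E\mathrm B_{y_0}+\mathrm C_{y_0}\mathcal K)\mathrm B_{y_0})+\Big(h-\mathrm K\tfrac{h^3}{12}\Big)W_{\mathrm{curv}}(\mathcal K)+\tfrac{h^3}{12}W_{\mathrm{curv}}(\mathcal K\mathrm B_{y_0}),\end{aligned}$$ where $$W_{\mathrm{shell}}(S)=\mu\lVert\mathrm{sym}\,S\rVert^2+\mu_{\rm c}\lVert\mathrm{skew}\,S\rVert^2+\tfrac{\lambda\mu}{\lambda+2\mu}[\mathrm{tr}\,S]^2,$$ $$\mathcal W_{\mathrm{shell}}(S,T)=\mu\langle\mathrm{sym}\,S,\mathrm{sym}\,T\rangle+\mu_{\rm c}\langle\mathrm{skew}\,S,\mathrm{skew}\,T\rangle+\tfrac{\lambda\mu}{\lambda+2\mu}\mathrm{tr}(S)\,\mathrm{tr}(T),$$ $$W_{\mathrm{curv}}(S)=\mu L_{\rm c}^2\big(b_1\lVert\mathrm{dev}\,\mathrm{sym}\,S\rVert^2+b_2\lVert\mathrm{skew}\,S\rVert^2+b_3[\mathrm{tr}\,S]^2\big).$$ Here $\mu,\lambda,\mu_{\rm c},b_1,b_2,b_3$ are real constitutive coefficients and $L_{\rm c}>0$ is a fixed internal length. Thus $c_1^+\lVert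 S\rVert^2\le W_{\mathrm{shell}}(S)\le C_1^+\lVert S\rVert^2$ and $c_2^+\lVert S\rVert^2\le W_{\mathrm{curv}}(S)$ for all $S\in\mathbb{R}^{3\times3}$, with optimal constants. *)

theory Defs
  imports "HOL-Analysis.Analysis"
begin

section \<open>Matrices\<close>

text \<open>
  \<open>real^'n^'m\<close> is the space of matrices with \<open>'m\<close> rows and \<open>'n\<close> columns. Its library inner product
  is the Frobenius product, so \<open>norm\<close> below is always the Frobenius norm.
\<close>

lemma inner_eq_trace:
  fixes X Y :: "real^'n^'m"
  shows "X \<bullet> Y = trace (X ** transpose Y)"
  by (simp add: inner_vec_def trace_def matrix_matrix_mult_def transpose_def)

definition symm :: "real^'n^'n \<Rightarrow> real^'n^'n" where
  "symm X = (1/2) *\<^sub>R (X + transpose X)"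

definition skew :: "real^'n^'n \<Rightarrow> real^'n^'n" where
  "skew X = (1/2) *\<^sub>R (X - transpose X)"

definition dev :: "real^3^3 \<Rightarrow> real^3^3" where
  "dev X = X - (trace X / 3) *\<^sub>R mat 1"

definition axl :: "real^3^3 \<Rightarrow> real^3" where
  "axl A = vector [- (A$2$3), A$1$3, - (A$1$2)]"

definition columns3 :: "real^3 \<Rightarrow> real^3 \<Rightarrow> real^3 \<Rightarrow> real^3^3" where
  "columns3 a b c = (\<chi> i. vector [a$i, b$i, c$i])"

definition append_column :: "real^2^3 \<Rightarrow> real^3 \<Rightarrow> real^3^3" where
  "append_column M v = (\<chi> i. vector [M$i$1, M$i$2, v$i])"

definition is_eigenvalue :: "real^'n^'n \<Rightarrow> real \<Rightarrow> bool" where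
  "is_eigenvalue A k \<longleftrightarrow> (\<exists>v. v \<noteq> 0 \<and> A *v v = k *\<^sub>R v)"


section \<open>Eigenvalues of a quadratic form\<close>

definition polar_form :: "('a::real_inner \<Rightarrow> real) \<Rightarrow> 'a \<Rightarrow> 'a \<Rightarrow> real" where
  "polar_form q S T = (q (S + T) - q S - q T) / 2"

text \<open>
  The eigenvalues of the self-adjoint operator representing \<open>q\<close> with respect to the inner product.
  For a quadratic form on a nontrivial Euclidean space this set is finite and nonempty, so that
  \<open>Min\<close> and \<open>Max\<close> below are meaningful.
\<close>

definition form_eigenvalues :: "('a::real_inner \<Rightarrow> real) \<Rightarrow> real set" where
  "form_eigenvalues q = {c. \<exists>S. S \<noteq> 0 \<and> (\<forall>T. polar_form q S T = c * (S \<bullet> T))}"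

definition smallest_eigenvalue :: "('a::real_inner \<Rightarrow> real) \<Rightarrow> real" where
  "smallest_eigenvalue q = Min (form_eigenvalues q)"

definition largest_eigenvalue :: "('a::real_inner \<Rightarrow> real) \<Rightarrow> real" where
  "largest_eigenvalue q = Max (form_eigenvalues q)"


section \<open>Differentiation\<close>

text \<open>
  Partial derivatives are derivatives along the coordinate lines. The value of \<open>partial j f x\<close> is
  meaningful only if that derivative exists.
\<close>

definition partial :: "'n \<Rightarrow> (real^'n \<Rightarrow> 'b::real_normed_vector) \<Rightarrow> real^'n \<Rightarrow> 'b" where
  "partial j f x = vector_derivative (\<lambda>t. f (x + t *\<^sub>R axis j 1)) (at 0)"

definition has_partials_at :: "(real^'n \<Rightarrow> 'b::real_normed_vector) \<Rightarrow> real^'n \<Rightarrow> bool" where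
  "has_partials_at f x \<longleftrightarrow> (\<forall>j. (\<lambda>t. f (x + t *\<^sub>R axis j 1)) differentiable (at 0))"

definition grad :: "(real^'n \<Rightarrow> real^'m) \<Rightarrow> real^'n \<Rightarrow> real^'n^'m" where
  "grad f x = (\<chi> i j. partial j f x $ i)"

text \<open>The following two notions are meant for open sets \<open>S\<close>.\<close>

definition C1_map :: "'a::real_normed_vector set \<Rightarrow> ('a \<Rightarrow> 'b::real_normed_vector) \<Rightarrow> bool" where
  "C1_map S f \<longleftrightarrow>
     (\<exists>f' :: 'a \<Rightarrow> 'a \<Rightarrow>\<^sub>L 'b.
        (\<forall>x\<in>S. (f has_derivative blinfun_apply (f' x)) (at x)) \<and> continuous_on S f')"

definition C2_map :: "'a::real_normed_vector set \<Rightarrow> ('a \<Rightarrow> 'b::real_normed_vector) \<Rightarrow> bool" where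
  "C2_map S f \<longleftrightarrow>
     (\<exists>f' :: 'a \<Rightarrow> 'a \<Rightarrow>\<^sub>L 'b.
        (\<forall>x\<in>S. (f has_derivative blinfun_apply (f' x)) (at x)) \<and> C1_map S f')"

definition C1_diffeo_onto_image ::
    "'a::real_normed_vector set \<Rightarrow> ('a \<Rightarrow> 'b::real_normed_vector) \<Rightarrow> bool" where
  "C1_diffeo_onto_image S f \<longleftrightarrow>
     inj_on f S \<and> open (f ` S) \<and> C1_map S f \<and> C1_map (f ` S) (inv_into S f)"


section \<open>The reference configuration\<close>

text \<open>
  Near each of its boundary points the set is, in suitable Cartesian coordinates \<open>(u, v)\<close> centred at
  that point, the strict epigraph of a Lipschitz function.
\<close>

definition lipschitz_boundary :: "(real^2) set \<Rightarrow> bool" where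
  "lipschitz_boundary \<omega> \<longleftrightarrow>
     (\<forall>p\<in>frontier \<omega>. \<exists>u v r L \<gamma>.
        norm u = 1 \<and> norm v = 1 \<and> u \<bullet> v = 0 \<and> r > 0 \<and> L-lipschitz_on UNIV (\<gamma> :: real \<Rightarrow> real) \<and>
        \<omega> \<inter> ball p r = {x \<in> ball p r. (x - p) \<bullet> v > \<gamma> ((x - p) \<bullet> u)})"

definition lipschitz_domain :: "(real^2) set \<Rightarrow> bool" where
  "lipschitz_domain \<omega> \<longleftrightarrow>
     open \<omega> \<and> connected \<omega> \<and> \<omega> \<noteq> {} \<and> bounded \<omega> \<and> lipschitz_boundary \<omega>"

definition unit_normal :: "(real^2 \<Rightarrow> real^3) \<Rightarrow> real^2 \<Rightarrow> real^3" where
  "unit_normal y0 x =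
     (let N = cross3 (partial 1 y0 x) (partial 2 y0 x) in (1 / norm N) *\<^sub>R N)"

definition plate :: "(real^2) set \<Rightarrow> real \<Rightarrow> (real^3) set" where
  "plate \<omega> h = {X. vector [X$1, X$2] \<in> \<omega> \<and> - h / 2 < X$3 \<and> X$3 < h / 2}"

definition Theta :: "(real^2 \<Rightarrow> real^3) \<Rightarrow> real^3 \<Rightarrow> real^3" where
  "Theta y0 X = (let x = vector [X$1, X$2] in y0 x + X$3 *\<^sub>R unit_normal y0 x)"

definition reference_configuration ::
    "(real^2) set \<Rightarrow> real \<Rightarrow> (real^2 \<Rightarrow> real^3) \<Rightarrow> bool" where
  "reference_configuration \<omega> h y0 \<longleftrightarrow>
     lipschitz_domain \<omega> \<and> h > 0 \<and> C2_map \<omega> y0 \<and>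
     C1_diffeo_onto_image (plate \<omega> h) (Theta y0)"

definition grad_Theta0 :: "(real^2 \<Rightarrow> real^3) \<Rightarrow> real^2 \<Rightarrow> real^3^3" where
  "grad_Theta0 y0 x = grad (Theta y0) (vector [x$1, x$2, 0])"

lemma grad_Theta0_eq:
  "grad_Theta0 y0 x = append_column (grad y0 x) (unit_normal y0 x)"
proof -
  have ext2: "u = v" if "u$1 = v$1" "u$2 = v$2" for u v :: "real^2"
    using that by (simp only: vec_eq_iff forall_2)
  let ?X = "vector [x$1, x$2, 0] :: real^3"
  have comps: "(?X + t *\<^sub>R axis 1 1)$1 = x$1 + t" "(?X + t *\<^sub>R axis 1 1)$2 = x$2"
    "(?X + t *\<^sub>R axis 1 1)$3 = 0" "(?X + t *\<^sub>R axis 2 1)$1 = x$1"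
    "(?X + t *\<^sub>R axis 2 1)$2 = x$2 + t" "(?X + t *\<^sub>R axis 2 1)$3 = 0"
    "(?X + t *\<^sub>R axis 3 1)$1 = x$1" "(?X + t *\<^sub>R axis 3 1)$2 = x$2"
    "(?X + t *\<^sub>R axis 3 1)$3 = t" for t
    by (simp_all add: axis_def)
  have vec1: "vector [x$1 + t, x$2] = x + t *\<^sub>R axis 1 1"
    and vec2: "vector [x$1, x$2 + t] = x + t *\<^sub>R axis 2 1"
    and vec3: "vector [x$1, x$2] = x" for t
    by (rule ext2; simp add: axis_def)+
  have 1: "partial 1 (Theta y0) ?X = partial 1 y0 x"
    unfolding partial_def Theta_def Let_def comps vec1 by simp
  have 2: "partial 2 (Theta y0) ?X = partial 2 y0 x"
    unfolding partial_def Theta_def Let_def comps vec2 by simp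
  have "((\<lambda>t. y0 x + t *\<^sub>R unit_normal y0 x) has_vector_derivative unit_normal y0 x) (at 0)"
    by (auto intro!: derivative_eq_intros)
  then have 3: "partial 3 (Theta y0) ?X = unit_normal y0 x"
    unfolding partial_def Theta_def Let_def comps vec3 by (rule vector_derivative_at)
  have "grad_Theta0 y0 x $ i $ j = append_column (grad y0 x) (unit_normal y0 x) $ i $ j" for i j
    using exhaust_3[of j] by (auto simp: grad_Theta0_def grad_def append_column_def 1 2 3)
  then show ?thesis
    by (simp add: vec_eq_iff)
qed

definition first_form :: "(real^2 \<Rightarrow> real^3) \<Rightarrow> real^2 \<Rightarrow> real^2^2" where
  "first_form y0 x = transpose (grad y0 x) ** grad y0 x"

definition second_form :: "(real^2 \<Rightarrow> real^3) \<Rightarrow> real^2 \<Rightarrow> real^2^2" where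
  "second_form y0 x = - (transpose (grad y0 x) ** grad (unit_normal y0) x)"

definition weingarten :: "(real^2 \<Rightarrow> real^3) \<Rightarrow> real^2 \<Rightarrow> real^2^2" where
  "weingarten y0 x = matrix_inv (first_form y0 x) ** second_form y0 x"

definition gauss_curvature :: "(real^2 \<Rightarrow> real^3) \<Rightarrow> real^2 \<Rightarrow> real" where
  "gauss_curvature y0 x = det (weingarten y0 x)"

definition mean_curvature :: "(real^2 \<Rightarrow> real^3) \<Rightarrow> real^2 \<Rightarrow> real" where
  "mean_curvature y0 x = trace (weingarten y0 x) / 2"

text \<open>
  The set of the principal curvatures \<open>\<kappa>\<^sub>1, \<kappa>\<^sub>2\<close>. For a regular \<open>C\<^sup>2\<close> surface the Weingarten map is
  self-adjoint with respect to the first fundamental form, so no eigenvalue is lost by working over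
  the reals.
\<close>

definition principal_curvatures :: "(real^2 \<Rightarrow> real^3) \<Rightarrow> real^2 \<Rightarrow> real set" where
  "principal_curvatures y0 x = {\<kappa>. is_eigenvalue (weingarten y0 x) \<kappa>}"

definition B_tensor :: "(real^2 \<Rightarrow> real^3) \<Rightarrow> real^2 \<Rightarrow> real^3^3" where
  "B_tensor y0 x =
     - (append_column (grad (unit_normal y0) x) 0 ** matrix_inv (grad_Theta0 y0 x))"

definition C_tensor :: "(real^2 \<Rightarrow> real^3) \<Rightarrow> real^2 \<Rightarrow> real^3^3" where
  "C_tensor y0 x =
     det (grad_Theta0 y0 x) *\<^sub>R
       (transpose (matrix_inv (grad_Theta0 y0 x)) **
        vector [vector [0, 1, 0], vector [-1, 0, 0], vector [0, 0, 0]] **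
        matrix_inv (grad_Theta0 y0 x))"


section \<open>Strain measures\<close>

definition shell_strain ::
    "(real^2 \<Rightarrow> real^3) \<Rightarrow> (real^2 \<Rightarrow> real^3) \<Rightarrow> (real^2 \<Rightarrow> real^3^3) \<Rightarrow> real^2 \<Rightarrow> real^3^3" where
  "shell_strain y0 m Q x =
     transpose (Q x) **
       append_column (grad m x) (Q x *v (grad_Theta0 y0 x *v axis 3 1)) **
       matrix_inv (grad_Theta0 y0 x)
     - mat 1"

definition bending_curvature ::
    "(real^2 \<Rightarrow> real^3) \<Rightarrow> (real^2 \<Rightarrow> real^3^3) \<Rightarrow> real^2 \<Rightarrow> real^3^3" where
  "bending_curvature y0 Q x =
     columns3 (axl (transpose (Q x) ** partial 1 Q x)) (axl (transpose (Q x) ** partial 2 Q x)) 0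
       ** matrix_inv (grad_Theta0 y0 x)"


section \<open>Energy density\<close>

definition W_shell :: "real \<Rightarrow> real \<Rightarrow> real \<Rightarrow> real^3^3 \<Rightarrow> real" where
  "W_shell mu lam muc S =
     mu * (norm (symm S))\<^sup>2 + muc * (norm (skew S))\<^sup>2 + lam * mu / (lam + 2 * mu) * (trace S)\<^sup>2"

definition W_shell_bilinear :: "real \<Rightarrow> real \<Rightarrow> real \<Rightarrow> real^3^3 \<Rightarrow> real^3^3 \<Rightarrow> real" where
  "W_shell_bilinear mu lam muc S T =
     mu * (symm S \<bullet> symm T) + muc * (skew S \<bullet> skew T)
     + lam * mu / (lam + 2 * mu) * trace S * trace T"

definition W_curv :: "real \<Rightarrow> real \<Rightarrow> real \<Rightarrow> real \<Rightarrow> real \<Rightarrow> real^3^3 \<Rightarrow> real" where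
  "W_curv mu Lc b1 b2 b3 S =
     mu * Lc\<^sup>2 * (b1 * (norm (dev (symm S)))\<^sup>2 + b2 * (norm (skew S))\<^sup>2 + b3 * (trace S)\<^sup>2)"

definition W_h3 ::
    "real \<Rightarrow> real \<Rightarrow> real \<Rightarrow> real \<Rightarrow> real \<Rightarrow> real \<Rightarrow> real \<Rightarrow> real \<Rightarrow>
     (real^2 \<Rightarrow> real^3) \<Rightarrow> real^2 \<Rightarrow> real^3^3 \<Rightarrow> real^3^3 \<Rightarrow> real" where
  "W_h3 mu lam muc Lc b1 b2 b3 h y0 x E K =
     (let B = B_tensor y0 x; C = C_tensor y0 x;
          GK = gauss_curvature y0 x; H = mean_curvature y0 x;
          F = E ** B + C ** K
      in (h + GK * h^3 / 12) * W_shell mu lam muc E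
         + h^3 / 12 * W_shell mu lam muc F
         - h^3 / 3 * H * W_shell_bilinear mu lam muc E F
         + h^3 / 6 * W_shell_bilinear mu lam muc E (F ** B)
         + (h - GK * h^3 / 12) * W_curv mu Lc b1 b2 b3 K
         + h^3 / 12 * W_curv mu Lc b1 b2 b3 (K ** B))"


section \<open>Thickness conditions\<close>

definition thickness_condition_i ::
    "real \<Rightarrow> real \<Rightarrow> (real^2) set \<Rightarrow> real \<Rightarrow> (real^2 \<Rightarrow> real^3) \<Rightarrow> bool" where
  "thickness_condition_i c2 C1 \<omega> h y0 \<longleftrightarrow>
     (\<forall>x\<in>\<omega>. \<forall>\<kappa>\<in>principal_curvatures y0 x. h * \<bar>\<kappa>\<bar> < 1/2) \<and>
     h\<^sup>2 < (47/4)\<^sup>2 * (5 - 2 * sqrt 6) * (c2 / C1)"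

definition thickness_condition_ii ::
    "real \<Rightarrow> real \<Rightarrow> (real^2) set \<Rightarrow> real \<Rightarrow> (real^2 \<Rightarrow> real^3) \<Rightarrow> bool" where
  "thickness_condition_ii c1 C1 \<omega> h y0 \<longleftrightarrow>
     (\<exists>a. a > max (1 + sqrt 2 / 2) ((1 + sqrt (1 + 3 * (C1 / c1))) / 2) \<and>
        (\<forall>x\<in>\<omega>. \<forall>\<kappa>\<in>principal_curvatures y0 x. h * \<bar>\<kappa>\<bar> < 1/a))"

end

theory Submission
  imports Defs
begin

text \<open>
  The estimate is pointwise. In the frame of the tangent plane and the unit normal \<open>n\<close>, the matrix
  \<open>B\<close> is the Weingarten map extended by \<open>0\<close> (symmetric, by the symmetry of second derivatives),
  \<open>C\<close> is \<open>v \<mapsto> v \<times> n\<close>, and both strain tensors annihilate \<open>n\<close>. With \<open>F = E B + C K\<close> the two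
  mixed terms combine to \<open>h\<^sup>3/6\<close> times the bilinear form at \<open>(E, F B - 2 H F)\<close>. On \<open>n\<^sup>\<bottom>\<close> the operator
  \<open>B - 2 H\<close> has the eigenvalues \<open>-\<kappa>\<^sub>2, -\<kappa>\<^sub>1\<close>, so \<open>\<parallel>F B - 2 H F\<parallel> \<le> k \<parallel>F\<parallel>\<close> when \<open>\<bar>\<kappa>\<^sub>i\<bar> \<le> k\<close>.
  Under condition ii) Young's inequality absorbs this term into the energies of \<open>E\<close> and \<open>F\<close>. Under
  condition i) one first uses \<open>E B (B - 2 H) = -det L E\<close>, so that only \<open>C K (B - 2 H)\<close> is coupled to \<open>E\<close>,
  and Young's inequality absorbs it into the energies of \<open>E\<close> and \<open>K\<close>. Both
  cases give \<open>a\<^sub>1 = h/2 min c\<^sub>1 c\<^sub>2\<close>.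
\<close>

section \<open>Isotropic quadratic forms\<close>

text \<open>Every quadratic form on 3x3 matrices that is invariant under conjugation by rotations
  has this shape. Both energies are instances, so their eigenvalues are computed together.\<close>

definition isotropic_form :: "real \<Rightarrow> real \<Rightarrow> real \<Rightarrow> real^3^3 \<Rightarrow> real" where
  "isotropic_form \<alpha> \<beta> \<gamma> S =
     \<alpha> * (norm (dev (symm S)))\<^sup>2 + \<beta> * (norm (skew S))\<^sup>2 + \<gamma> * (trace S)\<^sup>2"

lemma isotropic_form_pythagoras:
  "(norm S)\<^sup>2 = (norm (dev (symm S)))\<^sup>2 + (norm (skew S))\<^sup>2 + (trace S)\<^sup>2 / 3" for S :: "real^3^3"
  unfolding power2_norm_eq_inner
  by (simp add: dev_def symm_def skew_def trace_def transpose_def mat_def inner_vec_def sum_3)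
    (simp add: field_simps power2_eq_square)

lemma norm_symm: "(norm (symm S))\<^sup>2 = (norm (dev (symm S)))\<^sup>2 + (trace S)\<^sup>2 / 3" for S :: "real^3^3"
  unfolding power2_norm_eq_inner
  by (simp add: dev_def symm_def trace_def transpose_def mat_def inner_vec_def sum_3)
    (simp add: field_simps power2_eq_square)

lemma polar_form_isotropic_form:
  "polar_form (isotropic_form \<alpha> \<beta> \<gamma>) S T =
     \<alpha> * (dev (symm S) \<bullet> T) + \<beta> * (skew S \<bullet> T) + \<gamma> * (trace S * trace T)"
proof -
  have "(norm (dev (symm (S + T))))\<^sup>2 =
      (norm (dev (symm S)))\<^sup>2 + (norm (dev (symm T)))\<^sup>2 + 2 * (dev (symm S) \<bullet> T)"
    unfolding power2_norm_eq_inner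
    by (simp add: dev_def symm_def trace_def transpose_def mat_def inner_vec_def sum_3)
      (simp add: field_simps power2_eq_square)
  moreover have "(norm (skew (S + T)))\<^sup>2 = (norm (skew S))\<^sup>2 + (norm (skew T))\<^sup>2 + 2 * (skew S \<bullet> T)"
    unfolding power2_norm_eq_inner
    by (simp add: skew_def transpose_def inner_vec_def sum_3)
      (simp add: field_simps power2_eq_square)
  moreover have "trace (S + T) = trace S + trace T"
    by (rule trace_add)
  ultimately show ?thesis
    by (simp add: polar_form_def isotropic_form_def) (simp add: field_simps power2_eq_square)
qed

lemma isotropic_parts_inner:
  fixes S :: "real^3^3"
  shows "dev (symm S) \<bullet> dev (symm S) = S \<bullet> dev (symm S)" "skew S \<bullet> skew S = S \<bullet> skew S"
    "skew S \<bullet> dev (symm S) = 0" "trace (dev (symm S)) = 0" "trace (skew S) = 0"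
    "S = dev (symm S) + skew S + (trace S / 3) *\<^sub>R mat 1"
proof -
  show "dev (symm S) \<bullet> dev (symm S) = S \<bullet> dev (symm S)" "skew S \<bullet> skew S = S \<bullet> skew S"
    "skew S \<bullet> dev (symm S) = 0"
    by (simp add: dev_def symm_def skew_def trace_def transpose_def mat_def inner_vec_def sum_3;
        simp add: field_simps power2_eq_square)+
  show "trace (dev (symm S)) = 0" "trace (skew S) = 0"
    by (simp_all add: dev_def symm_def skew_def trace_def transpose_def mat_def sum_3 field_simps)
  show "S = dev (symm S) + skew S + (trace S / 3) *\<^sub>R mat 1"
    by (simp add: dev_def symm_def skew_def trace_def transpose_def mat_def vec_eq_iff forall_3 sum_3 field_simps)
qed

text \<open>The deviatoric symmetric, skew and spherical parts span mutually orthogonal eigenspaces.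
  The factor 3 arises because \<open>(trace S)\<^sup>2\<close> is three times the squared norm of
  the spherical part.\<close>

lemma form_eigenvalues_isotropic_form:
  "form_eigenvalues (isotropic_form \<alpha> \<beta> \<gamma>) = {\<alpha>, \<beta>, 3 * \<gamma>}"
proof (intro equalityI subsetI)
  fix c assume "c \<in> form_eigenvalues (isotropic_form \<alpha> \<beta> \<gamma>)"
  then obtain S :: "real^3^3" where "S \<noteq> 0"
    and eig: "\<And>T. \<alpha> * (dev (symm S) \<bullet> T) + \<beta> * (skew S \<bullet> T) + \<gamma> * (trace S * trace T) = c * (S \<bullet> T)"
    by (auto simp: form_eigenvalues_def polar_form_isotropic_form)
  note p = isotropic_parts_inner[of S]
  \<comment> \<open>Testing the eigenvalue equation against a multiple of a nonvanishing part
    removes the contributions of the other two.\<close>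
  consider "dev (symm S) \<noteq> 0" | "skew S \<noteq> 0" | "S = (trace S / 3) *\<^sub>R mat 1"
    using p(6) by (metis add_0)
  then show "c \<in> {\<alpha>, \<beta>, 3 * \<gamma>}"
  proof cases
    case 1
    then have "c = \<alpha>"
      using eig[of "dev (symm S)"] p(3,4) by (simp add: p(1)[symmetric])
    then show ?thesis by simp
  next
    case 2
    then have "c = \<beta>"
      using eig[of "skew S"] p(3,5) by (simp add: p(2)[symmetric] inner_commute)
    then show ?thesis by simp
  next
    case 3
    define t where "t = trace S / 3"
    have S: "S = t *\<^sub>R mat 1"
      using 3 by (simp add: t_def)
    have "t \<noteq> 0"
      using \<open>S \<noteq> 0\<close> S by auto
    have "dev (symm S) = 0" "skew S = 0" "trace S = 3 * t" "S \<bullet> mat 1 = 3 * t" "trace (mat 1 :: real^3^3) = 3"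
      unfolding S by (simp_all add: dev_def symm_def skew_def trace_def transpose_def mat_def
          vec_eq_iff forall_3 sum_3 inner_vec_def)
    with eig[of "mat 1"] \<open>t \<noteq> 0\<close> have "c = 3 * \<gamma>"
      by simp
    then show ?thesis by simp
  qed
next
  fix c assume "c \<in> {\<alpha>, \<beta>, 3 * \<gamma>}"
  then consider "c = \<alpha>" | "c = \<beta>" | "c = 3 * \<gamma>" by blast
  then show "c \<in> form_eigenvalues (isotropic_form \<alpha> \<beta> \<gamma>)"
  proof cases
    case 1
    define S :: "real^3^3" where "S = vector [vector [0, 1, 0], vector [1, 0, 0], vector [0, 0, 0]]"
    have "S$1$2 \<noteq> 0"
      by (simp add: S_def)
    then have "S \<noteq> 0" by (metis zero_index)
    moreover have "dev (symm S) = S" "skew S = 0" "trace S = 0"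
      by (simp_all add: S_def dev_def symm_def skew_def trace_def transpose_def mat_def
          vec_eq_iff forall_3 sum_3)
    ultimately show ?thesis
      using 1 by (auto simp: form_eigenvalues_def polar_form_isotropic_form)
  next
    case 2
    define S :: "real^3^3" where "S = vector [vector [0, 1, 0], vector [-1, 0, 0], vector [0, 0, 0]]"
    have "S$1$2 \<noteq> 0"
      by (simp add: S_def)
    then have "S \<noteq> 0" by (metis zero_index)
    moreover have "dev (symm S) = 0" "skew S = S" "trace S = 0"
      by (simp_all add: S_def dev_def symm_def skew_def trace_def transpose_def mat_def
          vec_eq_iff forall_3 sum_3)
    ultimately show ?thesis
      using 2 by (auto simp: form_eigenvalues_def polar_form_isotropic_form)
  next
    case 3
    have "(mat 1 :: real^3^3)$1$1 \<noteq> 0"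
      by (simp add: mat_def)
    then have "(mat 1 :: real^3^3) \<noteq> 0" by (metis zero_index)
    moreover have "dev (symm (mat 1)) = 0" "skew (mat 1 :: real^3^3) = 0" "trace (mat 1 :: real^3^3) = 3"
      by (simp_all add: dev_def symm_def skew_def trace_def transpose_def mat_def
          vec_eq_iff forall_3 sum_3)
    moreover have "mat 1 \<bullet> T = trace T" for T :: "real^3^3"
      by (simp add: mat_def trace_def inner_vec_def sum_3)
    ultimately show ?thesis
      using 3 by (auto simp: form_eigenvalues_def polar_form_isotropic_form)
  qed
qed

text \<open>The squared norm carries the weights 1, 1 and 1/3 on the same three squares, so the
  comparison holds coefficient by coefficient.\<close>

lemma isotropic_form_bounds:
  "smallest_eigenvalue (isotropic_form \<alpha> \<beta> \<gamma>) * (norm S)\<^sup>2 \<le> isotropic_form \<alpha> \<beta> \<gamma> S"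
  "isotropic_form \<alpha> \<beta> \<gamma> S \<le> largest_eigenvalue (isotropic_form \<alpha> \<beta> \<gamma>) * (norm S)\<^sup>2"
proof -
  have scale: "c * (norm S)\<^sup>2 = c * (norm (dev (symm S)))\<^sup>2 + c * (norm (skew S))\<^sup>2 + c / 3 * (trace S)\<^sup>2" for c
    by (simp add: isotropic_form_pythagoras[of S] algebra_simps)
  have "smallest_eigenvalue (isotropic_form \<alpha> \<beta> \<gamma>) \<le> v"
    and "v \<le> largest_eigenvalue (isotropic_form \<alpha> \<beta> \<gamma>)" if "v \<in> {\<alpha>, \<beta>, 3 * \<gamma>}" for v
    unfolding smallest_eigenvalue_def largest_eigenvalue_def form_eigenvalues_isotropic_form
    using that by (auto intro!: Min_le Max_ge)
  then have "smallest_eigenvalue (isotropic_form \<alpha> \<beta> \<gamma>) \<le> v \<and>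
      v \<le> largest_eigenvalue (isotropic_form \<alpha> \<beta> \<gamma>)" if "v \<in> {\<alpha>, \<beta>, 3 * \<gamma>}" for v
    using that by blast
  from this[of \<alpha>] this[of \<beta>] this[of "3 * \<gamma>"]
  show "smallest_eigenvalue (isotropic_form \<alpha> \<beta> \<gamma>) * (norm S)\<^sup>2 \<le> isotropic_form \<alpha> \<beta> \<gamma> S"
    "isotropic_form \<alpha> \<beta> \<gamma> S \<le> largest_eigenvalue (isotropic_form \<alpha> \<beta> \<gamma>) * (norm S)\<^sup>2"
    unfolding scale isotropic_form_def[of _ _ _ S] by (intro add_mono mult_right_mono; simp)+
qed

lemma smallest_eigenvalue_isotropic_form_pos:
  assumes "\<alpha> > 0" "\<beta> > 0" "\<gamma> > 0"
  shows "smallest_eigenvalue (isotropic_form \<alpha> \<beta> \<gamma>) > 0"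
  using assms by (simp add: smallest_eigenvalue_def form_eigenvalues_isotropic_form)

section \<open>The shell and curvature energies\<close>

lemma W_shell_isotropic:
  "W_shell mu lam muc = isotropic_form mu muc (mu / 3 + lam * mu / (lam + 2 * mu))"
  by (rule ext) (simp add: W_shell_def isotropic_form_def norm_symm algebra_simps)

lemma W_curv_isotropic:
  "W_curv mu Lc b1 b2 b3 = isotropic_form (mu * Lc\<^sup>2 * b1) (mu * Lc\<^sup>2 * b2) (mu * Lc\<^sup>2 * b3)"
  by (rule ext) (simp add: W_curv_def isotropic_form_def algebra_simps)

text \<open>Three times this number is the spherical eigenvalue of \<open>W_shell\<close>. Over a
  common denominator the factor \<open>2 * lam + mu\<close> appears; together with
  \<open>mu > 0\<close> its positivity also gives \<open>lam + 2 * mu > 0\<close>.\<close>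

lemma W_shell_trace_coefficient_pos:
  fixes mu lam :: real
  assumes "mu > 0" "2 * lam + mu > 0"
  shows "mu / 3 + lam * mu / (lam + 2 * mu) > 0"
proof -
  have "mu / 3 + lam * mu / (lam + 2 * mu) = 2 * mu * (2 * lam + mu) / (3 * (lam + 2 * mu))"
    using assms by (simp add: field_simps)
  also have "\<dots> > 0"
    using assms by simp
  finally show ?thesis .
qed

lemma W_shell_add_scaleR:
  "W_shell mu lam muc (S + r *\<^sub>R T) =
     W_shell mu lam muc S + 2 * r * W_shell_bilinear mu lam muc S T + r\<^sup>2 * W_shell mu lam muc T"
proof -
  have lin: "symm (S + r *\<^sub>R T) = symm S + r *\<^sub>R symm T" "skew (S + r *\<^sub>R T) = skew S + r *\<^sub>R skew T"
    "trace (S + r *\<^sub>R T) = trace S + r * trace T"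
    by (simp_all add: symm_def skew_def trace_def transpose_def vec_eq_iff sum.distrib sum_distrib_left algebra_simps)
  show ?thesis
    unfolding W_shell_def W_shell_bilinear_def power2_norm_eq_inner lin
    by (simp add: inner_simps inner_commute[of "symm T" "symm S"] inner_commute[of "skew T" "skew S"]
        algebra_simps power2_eq_square)
qed

lemma W_shell_bilinear_add_right:
  "W_shell_bilinear mu lam muc S (r *\<^sub>R T + s *\<^sub>R U) =
     r * W_shell_bilinear mu lam muc S T + s * W_shell_bilinear mu lam muc S U"
proof -
  have lin: "symm (r *\<^sub>R T + s *\<^sub>R U) = r *\<^sub>R symm T + s *\<^sub>R symm U"
    "skew (r *\<^sub>R T + s *\<^sub>R U) = r *\<^sub>R skew T + s *\<^sub>R skew U"
    "trace (r *\<^sub>R T + s *\<^sub>R U) = r * trace T + s * trace U"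
    by (simp_all add: symm_def skew_def trace_def transpose_def vec_eq_iff sum.distrib sum_distrib_left algebra_simps)
  show ?thesis
    unfolding W_shell_bilinear_def lin by (simp add: inner_simps algebra_simps add_divide_distrib)
qed

lemma W_shell_bilinear_self: "W_shell_bilinear mu lam muc S S = W_shell mu lam muc S"
  unfolding W_shell_def W_shell_bilinear_def power2_norm_eq_inner by (simp add: power2_eq_square)

text \<open>Expand \<open>t\<close> times the nonnegative energy of
  \<open>S + (1 / t) *\<^sub>R T\<close>. The weight \<open>t\<close> stays free, since the two
  thickness conditions call for different choices.\<close>

lemma W_shell_bilinear_young:
  assumes nonneg: "\<And>S. W_shell mu lam muc S \<ge> 0" and "t > 0"
  shows "2 * W_shell_bilinear mu lam muc S T \<ge> - (t * W_shell mu lam muc S + W_shell mu lam muc T / t)"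
proof -
  have "0 \<le> t * W_shell mu lam muc (S + (1 / t) *\<^sub>R T)"
    using assms by simp
  also have "\<dots> = t * W_shell mu lam muc S + 2 * W_shell_bilinear mu lam muc S T + W_shell mu lam muc T / t"
    using \<open>t > 0\<close> unfolding W_shell_add_scaleR by (simp add: field_simps power2_eq_square)
  finally show ?thesis by simp
qed

section \<open>Coercivity at a point\<close>

lemma symmetric_matrix_inner:
  fixes S :: "real^'n^'n"
  assumes "transpose S = S"
  shows "(S *v u) \<bullet> w = u \<bullet> (S *v w)"
  by (metis assms dot_lmul_matrix vector_transpose_matrix)

lemma norm_square_rows: "(norm X)\<^sup>2 = (\<Sum>i\<in>UNIV. (norm (X$i))\<^sup>2)" for X :: "real^'n^'m"
  by (simp add: power2_norm_eq_inner inner_vec_def)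

lemma norm_transpose: "norm (transpose X) = norm X" for X :: "real^'n^'m"
proof -
  have "transpose X \<bullet> transpose X = X \<bullet> X"
    by (simp add: inner_vec_def transpose_def) (rule sum.swap)
  then show ?thesis
    by (simp add: norm_eq_sqrt_inner)
qed

text \<open>For symmetric \<open>S\<close> the rows of \<open>F ** S\<close> are the images under
  \<open>S\<close> of the rows of \<open>F\<close>. A bound on the rows suffices, which matters
  because \<open>B - 2 H\<close> is controlled by \<open>k\<close> only on the tangent
  plane.\<close>

lemma norm_matrix_mult_symmetric_le:
  fixes F :: "real^'n^'m" and S :: "real^'n^'n"
  assumes "transpose S = S" "\<And>i. norm (S *v F$i) \<le> k * norm (F$i)" "k \<ge> 0"
  shows "norm (F ** S) \<le> k * norm F"
proof (rule power2_le_imp_le)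
  have row: "(F ** S)$i = S *v F$i" for i
    by (subst assms(1)[symmetric])
      (simp add: vec_eq_iff matrix_matrix_mult_def matrix_vector_mult_def transpose_def mult.commute)
  have "(norm (S *v F$i))\<^sup>2 \<le> k\<^sup>2 * (norm (F$i))\<^sup>2" for i
    using power_mono[OF assms(2), of i 2] by (simp add: power_mult_distrib)
  then show "(norm (F ** S))\<^sup>2 \<le> (k * norm F)\<^sup>2"
    unfolding norm_square_rows[of "F ** S"] row power_mult_distrib norm_square_rows[of F] sum_distrib_left
    by (intro sum_mono)
  show "0 \<le> k * norm F"
    using \<open>k \<ge> 0\<close> by simp
qed

lemma norm_contraction_mult_le:
  fixes C :: "real^'n^'n" and M :: "real^'m^'n"
  assumes "\<And>v. norm (C *v v) \<le> norm v"
  shows "norm (C ** M) \<le> norm M"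
proof (rule power2_le_imp_le)
  have column: "transpose (C ** M) $ j = C *v (transpose M $ j)" for j
    by (simp add: vec_eq_iff matrix_matrix_mult_def matrix_vector_mult_def transpose_def)
  show "(norm (C ** M))\<^sup>2 \<le> (norm M)\<^sup>2"
    unfolding norm_transpose[of "C ** M", symmetric] norm_transpose[of M, symmetric] norm_square_rows column
    by (intro sum_mono power_mono assms) simp
qed simp

text \<open>
  The vector \<open>v\<close> lies in the sum of the eigenspaces of \<open>S\<close> belonging to the roots of
  \<open>z\<^sup>2 - s z + p\<close>; completing the square avoids splitting it into eigenvectors.
\<close>

lemma symmetric_quadratic_vector:
  fixes S :: "real^'n^'n"
  assumes sym: "transpose S = S" and v: "S *v (S *v v) = s *\<^sub>R (S *v v) - p *\<^sub>R v"
  shows "(norm (S *v v - (s / 2) *\<^sub>R v))\<^sup>2 = (s\<^sup>2 / 4 - p) * (norm v)\<^sup>2"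
proof -
  have "(S *v v) \<bullet> (S *v v) = s * (v \<bullet> (S *v v)) - p * (v \<bullet> v)"
    using symmetric_matrix_inner[OF sym, of v "S *v v"] v by (simp add: inner_diff_right)
  then show ?thesis
    unfolding power2_norm_eq_inner
    by (simp add: inner_diff_left inner_diff_right inner_commute[of "S *v v" v]
        algebra_simps power2_eq_square)
qed

text \<open>By \<open>symmetric_quadratic_vector\<close> the discriminant times a positive number is
  a square, so both roots are real. The left side of the second bound is the larger modulus of the
  roots.\<close>

lemma symmetric_quadratic_roots:
  fixes S :: "real^'n^'n"
  assumes sym: "transpose S = S" and v: "S *v (S *v v) = s *\<^sub>R (S *v v) - p *\<^sub>R v" and "v \<noteq> 0"
    and roots: "\<And>z. z\<^sup>2 - s * z + p = 0 \<Longrightarrow> \<bar>z\<bar> \<le> k"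
  shows "s\<^sup>2 / 4 - p \<ge> 0" "\<bar>s\<bar> / 2 + sqrt (s\<^sup>2 / 4 - p) \<le> k"
proof -
  have "0 \<le> (s\<^sup>2 / 4 - p) * (norm v)\<^sup>2"
    using symmetric_quadratic_vector[OF sym v] by (metis zero_le_power2)
  then show d: "s\<^sup>2 / 4 - p \<ge> 0"
    using \<open>v \<noteq> 0\<close> by (simp add: zero_le_mult_iff)
  define r where "r = sqrt (s\<^sup>2 / 4 - p)"
  have "r \<ge> 0" "r\<^sup>2 = s\<^sup>2 / 4 - p"
    using d by (simp_all add: r_def)
  then have "(s / 2 + r)\<^sup>2 - s * (s / 2 + r) + p = 0" "(s / 2 - r)\<^sup>2 - s * (s / 2 - r) + p = 0"
    by (simp_all add: power2_eq_square field_simps)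
  then have "\<bar>s / 2 + r\<bar> \<le> k" "\<bar>s / 2 - r\<bar> \<le> k"
    by (auto dest: roots)
  then show "\<bar>s\<bar> / 2 + sqrt (s\<^sup>2 / 4 - p) \<le> k"
    using \<open>r \<ge> 0\<close> unfolding r_def[symmetric] by linarith
qed

text \<open>Center at the midpoint \<open>s / 2\<close> of the roots: the deviation has norm exactly
  \<open>r * norm v\<close>, and the triangle inequality gives the factor
  \<open>\<bar>s\<bar> / 2 + r\<close>.\<close>

lemma symmetric_quadratic_norm_le:
  fixes S :: "real^'n^'n"
  assumes sym: "transpose S = S" and v: "S *v (S *v v) = s *\<^sub>R (S *v v) - p *\<^sub>R v"
    and roots: "\<And>z. z\<^sup>2 - s * z + p = 0 \<Longrightarrow> \<bar>z\<bar> \<le> k"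
  shows "norm (S *v v) \<le> k * norm v"
proof (cases "v = 0")
  case False
  define r where "r = sqrt (s\<^sup>2 / 4 - p)"
  note d = symmetric_quadratic_roots[OF sym v False roots]
  have "r \<ge> 0"
    using d by (simp add: r_def)
  have "(norm (S *v v - (s / 2) *\<^sub>R v))\<^sup>2 = (r * norm v)\<^sup>2"
    using symmetric_quadratic_vector[OF sym v] d by (simp add: r_def power_mult_distrib)
  then have "norm (S *v v - (s / 2) *\<^sub>R v) = r * norm v"
    using \<open>r \<ge> 0\<close> by (simp add: power2_eq_iff_nonneg)
  moreover have "norm (S *v v) \<le> norm (S *v v - (s / 2) *\<^sub>R v) + norm ((s / 2) *\<^sub>R v)"
    by (metis diff_add_cancel norm_triangle_ineq)
  ultimately have "norm (S *v v) \<le> (\<bar>s\<bar> / 2 + r) * norm v"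
    by (simp add: algebra_simps)
  also have "\<dots> \<le> k * norm v"
    using d by (intro mult_right_mono) (simp_all add: r_def)
  finally show ?thesis .
qed simp

text \<open>The number \<open>p\<close> is the product of the two real roots.\<close>

lemma symmetric_quadratic_product_le:
  fixes S :: "real^'n^'n"
  assumes sym: "transpose S = S" and v: "S *v (S *v v) = s *\<^sub>R (S *v v) - p *\<^sub>R v" and "v \<noteq> 0"
    and roots: "\<And>z. z\<^sup>2 - s * z + p = 0 \<Longrightarrow> \<bar>z\<bar> \<le> k"
  shows "\<bar>p\<bar> \<le> k\<^sup>2"
proof -
  define r where "r = sqrt (s\<^sup>2 / 4 - p)"
  note d = symmetric_quadratic_roots[OF assms]
  have "r \<ge> 0" "r\<^sup>2 = s\<^sup>2 / 4 - p"
    using d by (simp_all add: r_def)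
  then have "p = (\<bar>s\<bar> / 2 + r) * (\<bar>s\<bar> / 2 - r)"
    by (simp add: power2_eq_square field_simps)
  then have "\<bar>p\<bar> = (\<bar>s\<bar> / 2 + r) * \<bar>\<bar>s\<bar> / 2 - r\<bar>"
    using \<open>r \<ge> 0\<close> by (simp add: abs_mult)
  also have "\<dots> \<le> k * k"
    using d \<open>r \<ge> 0\<close> by (intro mult_mono) (auto simp: r_def[symmetric])
  finally show ?thesis
    by (simp add: power2_eq_square)
qed

section \<open>Algebra of an abstract shell at a point\<close>

lemma matrix_mult_shift:
  fixes F :: "real^'n^'m" and B :: "real^'n^'n"
  shows "F ** B - s *\<^sub>R F = F ** (B - s *\<^sub>R mat 1)" "(B - s *\<^sub>R mat 1) *v v = B *v v - s *\<^sub>R v"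
    "transpose (B - s *\<^sub>R mat 1) = transpose B - s *\<^sub>R mat 1"
proof -
  have "F ** (B - s *\<^sub>R mat 1) = F ** B - F ** (s *\<^sub>R mat 1)"
    by (simp add: vec_eq_iff matrix_matrix_mult_def algebra_simps sum_subtractf)
  also have "F ** (s *\<^sub>R mat 1) = s *\<^sub>R F"
    by (metis matrix_mul_rid matrix_scalar_ac)
  finally show "F ** B - s *\<^sub>R F = F ** (B - s *\<^sub>R mat 1)" ..
  show "(B - s *\<^sub>R mat 1) *v v = B *v v - s *\<^sub>R v"
    by (simp add: matrix_vector_mult_diff_rdistrib scaleR_matrix_vector_assoc[symmetric])
  show "transpose (B - s *\<^sub>R mat 1) = transpose B - s *\<^sub>R mat 1"
    by (auto simp: transpose_def mat_def vec_eq_iff)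
qed

lemma matrix_mult_add_left: "(A + B) ** C = A ** C + B ** C" for A B :: "real^'n^'m"
  by (simp add: vec_eq_iff matrix_matrix_mult_def algebra_simps sum.distrib)

lemma matrix_vector_row: "(F *v n) $ i = F$i \<bullet> n" for F :: "real^'n^'m"
  by (simp add: matrix_vector_mult_def inner_vec_def)

text \<open>The algebraic facts that the energy estimates use. \<open>H\<close> and
  \<open>\<kappa>\<close> are the mean and the Gauss curvature, so \<open>roots\<close> says that
  \<open>k\<close> bounds the principal curvatures. Cayley-Hamilton is limited to vectors orthogonal
  to \<open>n\<close>, since \<open>B\<close> has the further eigenvalue 0 along
  \<open>n\<close>.\<close>

locale curved_shell =
  fixes B C :: "real^3^3" and n :: "real^3" and H \<kappa> k :: real
  assumes symmetric: "transpose B = B" and normal: "B *v n = 0"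
    and cayley_hamilton: "v \<bullet> n = 0 \<Longrightarrow> B *v (B *v v) = (2 * H) *\<^sub>R (B *v v) - \<kappa> *\<^sub>R v"
    and contraction: "norm (C *v v) \<le> norm v"
    and roots: "z\<^sup>2 - 2 * H * z + \<kappa> = 0 \<Longrightarrow> \<bar>z\<bar> \<le> k"
    and gauss: "\<bar>\<kappa>\<bar> \<le> k\<^sup>2" and k_nonneg: "k \<ge> 0"
begin

text \<open>On tangent vectors \<open>B - 2 H\<close> satisfies the quadratic relation of
  \<open>B\<close> with \<open>H\<close> replaced by \<open>-H\<close>; its roots are the negatives
  of the principal curvatures.\<close>

lemma shifted_bound:
  assumes "F *v n = 0"
  shows "norm (F ** B - (2 * H) *\<^sub>R F) \<le> k * norm (F :: real^3^'m)"
  unfolding matrix_mult_shift(1)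
proof (rule norm_matrix_mult_symmetric_le)
  show sym: "transpose (B - (2 * H) *\<^sub>R mat 1) = B - (2 * H) *\<^sub>R mat 1"
    by (simp add: matrix_mult_shift symmetric)
  fix i
  let ?v = "F$i"
  have "?v \<bullet> n = 0"
    using assms by (metis matrix_vector_row zero_index)
  note ch = cayley_hamilton[OF this]
  show "norm ((B - (2 * H) *\<^sub>R mat 1) *v ?v) \<le> k * norm ?v"
  proof (rule symmetric_quadratic_norm_le[OF sym])
    show "(B - (2 * H) *\<^sub>R mat 1) *v ((B - (2 * H) *\<^sub>R mat 1) *v ?v)
        = (- 2 * H) *\<^sub>R ((B - (2 * H) *\<^sub>R mat 1) *v ?v) - \<kappa> *\<^sub>R ?v"
      unfolding matrix_mult_shift(2)
      by (simp add: matrix_vector_mult_diff_distrib matrix_vector_mult_scaleR ch algebra_simps)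
    show "\<bar>z\<bar> \<le> k" if "z\<^sup>2 - - 2 * H * z + \<kappa> = 0" for z
      using roots[of "- z"] that by simp
  qed
qed (rule k_nonneg)

text \<open>The rows of \<open>E\<close> are orthogonal to \<open>n\<close>, so Cayley-Hamilton
  applies to each of them.\<close>

lemma shifted_square:
  assumes "E *v n = 0"
  shows "(E ** B) ** B - (2 * H) *\<^sub>R (E ** B) = - \<kappa> *\<^sub>R (E :: real^3^'m)"
proof -
  have row: "(F ** B)$i = B *v F$i" for F :: "real^3^'m" and i
    by (subst symmetric[symmetric])
      (simp add: vec_eq_iff matrix_matrix_mult_def matrix_vector_mult_def transpose_def mult.commute)
  have "E$i \<bullet> n = 0" for i
    using assms by (metis matrix_vector_row zero_index)
  note ch = cayley_hamilton[OF this]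
  have "((E ** B) ** B - (2 * H) *\<^sub>R (E ** B)) $ i = (- \<kappa> *\<^sub>R E) $ i" for i
    by (simp add: row ch)
  then show ?thesis
    by (simp add: vec_eq_iff)
qed

context
  fixes mu lam muc Lc b1 b2 b3 c1 C1 c2 h :: real and E K F :: "real^3^3"
  assumes shell_lower: "\<And>S. c1 * (norm S)\<^sup>2 \<le> W_shell mu lam muc S"
    and shell_upper: "\<And>S. W_shell mu lam muc S \<le> C1 * (norm S)\<^sup>2"
    and curv_lower: "\<And>S. c2 * (norm S)\<^sup>2 \<le> W_curv mu Lc b1 b2 b3 S"
    and c_pos: "c1 > 0" "c2 > 0" and h_pos: "h > 0"
    and E_normal: "E *v n = 0" and K_normal: "K *v n = 0" and F_def: "F = E ** B + C ** K"
begin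

section \<open>Energy estimates under the two thickness conditions\<close>

abbreviation (input) "WS \<equiv> W_shell mu lam muc"
abbreviation (input) "WB \<equiv> W_shell_bilinear mu lam muc"
abbreviation (input) "WC \<equiv> W_curv mu Lc b1 b2 b3"

abbreviation (input) "energy \<equiv>
  (h + \<kappa> * h^3 / 12) * WS E + h^3 / 12 * WS F - h^3 / 3 * H * WB E F + h^3 / 6 * WB E (F ** B)
  + (h - \<kappa> * h^3 / 12) * WC K + h^3 / 12 * WC (K ** B)"

lemma energy_eq:
  "energy = (h + \<kappa> * h^3 / 12) * WS E + h^3 / 12 * WS F + h^3 / 6 * WB E (F ** B - (2 * H) *\<^sub>R F)
    + (h - \<kappa> * h^3 / 12) * WC K + h^3 / 12 * WC (K ** B)"
proof -
  have shift: "WB E (F ** B - (2 * H) *\<^sub>R F) = WB E (F ** B) - 2 * H * WB E F"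
    using W_shell_bilinear_add_right[of mu lam muc E 1 "F ** B" "- 2 * H" F] by simp
  show ?thesis
    unfolding shift by (simp add: algebra_simps)
qed

lemma C_K_normal: "(C ** K) *v n = 0"
  by (simp add: matrix_vector_mul_assoc[symmetric] K_normal)

lemma F_normal: "F *v n = 0"
  by (simp add: F_def matrix_vector_mult_add_rdistrib C_K_normal)
     (simp add: matrix_vector_mul_assoc[symmetric] normal)

text \<open>
  Cayley-Hamilton turns the part \<open>E ** B\<close> of \<open>F\<close> in the mixed term into a multiple of \<open>E\<close>, so that
  only the curvature remains coupled to \<open>E\<close>.
\<close>

lemma mixed_term:
  "WB E (F ** B - (2 * H) *\<^sub>R F) = - \<kappa> * WS E + WB E ((C ** K) ** B - (2 * H) *\<^sub>R (C ** K))"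
proof -
  have "F ** B - (2 * H) *\<^sub>R F =
      (- \<kappa>) *\<^sub>R E + 1 *\<^sub>R ((C ** K) ** B - (2 * H) *\<^sub>R (C ** K))"
    using shifted_square[OF E_normal]
    by (simp add: F_def matrix_mult_add_left algebra_simps)
  then show ?thesis
    unfolding W_shell_bilinear_add_right[of mu lam muc E "- \<kappa>" E 1]
    by (simp only: W_shell_bilinear_add_right W_shell_bilinear_self mult_1)
qed

lemma WS_nonneg: "WS S \<ge> 0"
  using shell_lower[of S] c_pos by (meson dual_order.trans less_imp_le mult_nonneg_nonneg zero_le_power2)

lemma WC_nonneg: "WC S \<ge> 0"
  using curv_lower[of S] c_pos by (meson dual_order.trans less_imp_le mult_nonneg_nonneg zero_le_power2)

lemma c1_le_C1: "C1 \<ge> c1"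
proof -
  have "c1 * (norm (mat 1 :: real^3^3))\<^sup>2 \<le> C1 * (norm (mat 1 :: real^3^3))\<^sup>2"
    using shell_lower shell_upper by (rule order_trans)
  moreover have "(norm (mat 1 :: real^3^3))\<^sup>2 > 0"
    by (simp add: power2_norm_eq_inner inner_vec_def mat_def sum_3)
  ultimately show ?thesis
    by simp
qed

lemma shell_shifted_le:
  assumes "X *v n = 0"
  shows "WS (X ** B - (2 * H) *\<^sub>R X) \<le> C1 * k\<^sup>2 * (norm X)\<^sup>2"
proof -
  have "(norm (X ** B - (2 * H) *\<^sub>R X))\<^sup>2 \<le> (k * norm X)\<^sup>2"
    by (intro power_mono shifted_bound assms) simp
  then have "C1 * (norm (X ** B - (2 * H) *\<^sub>R X))\<^sup>2 \<le> C1 * (k * norm X)\<^sup>2"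
    using c1_le_C1 c_pos by (intro mult_left_mono) auto
  then show ?thesis
    using shell_upper[of "X ** B - (2 * H) *\<^sub>R X"] by (simp add: power_mult_distrib)
qed

text \<open>Since \<open>h\<^sup>2 * \<bar>\<kappa>\<bar>\<close> is at most
  \<open>(h * k)\<^sup>2\<close>, the Gauss curvature changes the leading coefficients
  \<open>h\<close> only by a small fraction.\<close>

lemma gauss_scaled:
  assumes "h * k \<le> \<epsilon>"
  shows "\<bar>\<kappa> * h^3\<bar> \<le> h * \<epsilon>\<^sup>2"
proof -
  have "\<bar>\<kappa> * h^3\<bar> = h * (h\<^sup>2 * \<bar>\<kappa>\<bar>)"
    using h_pos by (simp add: abs_mult power2_eq_square power3_eq_cube)
  also have "\<dots> \<le> h * (h * k)\<^sup>2"
    using gauss h_pos by (simp add: power_mult_distrib)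
  also have "\<dots> \<le> h * \<epsilon>\<^sup>2"
    using assms h_pos k_nonneg by (intro mult_left_mono power_mono) auto
  finally show ?thesis .
qed

text \<open>Common end of both regimes: it suffices that half of each leading term survives the
  absorption.\<close>

lemma half_bounds:
  assumes "energy \<ge> h / 2 * WS E + h / 2 * c2 * (norm K)\<^sup>2"
  shows "energy \<ge> h / 2 * min c1 c2 * ((norm E)\<^sup>2 + (norm K)\<^sup>2)"
proof -
  have "h / 2 * min c1 c2 * ((norm E)\<^sup>2 + (norm K)\<^sup>2)
      = h / 2 * (min c1 c2 * (norm E)\<^sup>2) + h / 2 * min c1 c2 * (norm K)\<^sup>2"
    by (simp add: algebra_simps)
  also have "\<dots> \<le> h / 2 * WS E + h / 2 * c2 * (norm K)\<^sup>2"
  proof (intro add_mono mult_left_mono mult_right_mono)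
    show "min c1 c2 * (norm E)\<^sup>2 \<le> WS E"
      using shell_lower[of E] by (meson min.cobounded1 mult_right_mono order_trans zero_le_power2)
  qed (use h_pos in auto)
  finally show ?thesis
    using assms by linarith
qed

lemma coercive_small_thickness:
  assumes "h * k \<le> 1/2" and small: "h\<^sup>2 * C1 \<le> (47/4)\<^sup>2 * (5 - 2 * sqrt 6) * c2"
  shows "energy \<ge> h / 2 * min c1 c2 * ((norm E)\<^sup>2 + (norm K)\<^sup>2)"
proof (rule half_bounds)
  define Y where "Y = (C ** K) ** B - (2 * H) *\<^sub>R (C ** K)"
  \<comment> \<open>Divided by 12 this is a loss of \<open>h / 48\<close>, the source of the factor
    47/48 below.\<close>
  have kh: "\<bar>\<kappa> * h^3\<bar> \<le> h / 4"
    using gauss_scaled[OF assms(1)] by (simp add: power2_eq_square)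
  \<comment> \<open>This gives \<open>5 - 2 * sqrt 6 \<le> 1/5\<close>, and
    \<open>(47/4)\<^sup>2 / 5 = 2209/80\<close> is below 30.\<close>
  have "sqrt 6 \<ge> (12/5 :: real)"
    by (rule real_le_rsqrt) (simp add: power2_eq_square)
  then have "(47/4)\<^sup>2 * (5 - 2 * sqrt 6) * c2 \<le> (47/4)\<^sup>2 * (1/5) * c2"
    using c_pos by (intro mult_right_mono mult_left_mono) auto
  also have "\<dots> \<le> 30 * c2"
    using c_pos by (simp add: power2_eq_square)
  finally have small': "h\<^sup>2 * C1 \<le> 30 * c2"
    using small by simp
  have "WS Y \<le> C1 * k\<^sup>2 * (norm (C ** K))\<^sup>2"
    unfolding Y_def by (rule shell_shifted_le[OF C_K_normal])
  also have "\<dots> \<le> C1 * k\<^sup>2 * (norm K)\<^sup>2"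
    using c1_le_C1 c_pos by (intro mult_left_mono power_mono norm_contraction_mult_le contraction) auto
  finally have "h^4 * WS Y \<le> h\<^sup>2 * C1 * (h * k)\<^sup>2 * (norm K)\<^sup>2"
    using h_pos by (simp add: power2_eq_square power4_eq_xxxx algebra_simps)
  also have "\<dots> \<le> (30 * c2) * (1/2)\<^sup>2 * (norm K)\<^sup>2"
  proof (intro mult_right_mono)
    show "h\<^sup>2 * C1 * (h * k)\<^sup>2 \<le> 30 * c2 * (1/2)\<^sup>2"
      by (rule mult_mono[OF small' power_mono]) (use assms(1) h_pos k_nonneg c_pos in auto)
  qed simp
  finally have "h * (h^4 * WS Y) \<le> h * (30 / 4 * c2 * (norm K)\<^sup>2)"
    using h_pos by (simp add: power2_eq_square)
  moreover have "h^3 / 6 * WB E Y \<ge> - (h / 4 * WS E + h * (h^4 * WS Y) / 36)"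
  proof -
    \<comment> \<open>The weight \<open>3 / h\<^sup>2\<close> charges \<open>h / 4\<close> to the
      energy of \<open>E\<close>. The other part costs at most \<open>(30/4) / 36 = 5/24\<close> of
      \<open>h * c2 * (norm K)\<^sup>2\<close>.\<close>
    have "2 * WB E Y \<ge> - (3 / h\<^sup>2 * WS E + WS Y / (3 / h\<^sup>2))"
      using h_pos WS_nonneg by (intro W_shell_bilinear_young) auto
    then have "h^3 / 12 * (2 * WB E Y) \<ge> h^3 / 12 * (- (3 / h\<^sup>2 * WS E + WS Y / (3 / h\<^sup>2)))"
      using h_pos by (intro mult_left_mono) auto
    also have "h^3 / 12 * (- (3 / h\<^sup>2 * WS E + WS Y / (3 / h\<^sup>2))) = - (h / 4 * WS E + h * (h^4 * WS Y) / 36)"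
      using h_pos by (simp add: field_simps power2_eq_square power3_eq_cube power4_eq_xxxx)
    finally show ?thesis by simp
  qed
  moreover have "(h - \<kappa> * h^3 / 12) * WS E \<ge> 47 / 48 * (h * WS E)"
    unfolding mult.assoc[symmetric]
    using kh WS_nonneg by (intro mult_right_mono) auto
  moreover have "(h - \<kappa> * h^3 / 12) * WC K \<ge> 47 / 48 * (h * (c2 * (norm K)\<^sup>2))"
    unfolding mult.assoc[of _ h, symmetric]
    using kh curv_lower c_pos h_pos by (intro mult_mono) auto
  moreover have "h^3 / 12 * WS F \<ge> 0" "h^3 / 12 * WC (K ** B) \<ge> 0" "h * WS E \<ge> 0" "h * (c2 * (norm K)\<^sup>2) \<ge> 0"
    using WS_nonneg WC_nonneg h_pos c_pos by auto
  \<comment> \<open>The summand \<open>- \<kappa> * WS E\<close> of \<open>mixed_term\<close>, times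
    \<open>h^3 / 6\<close>, flips the sign of the Gauss curvature in the first coefficient.\<close>
  moreover have "energy = (h - \<kappa> * h^3 / 12) * WS E + h^3 / 12 * WS F + h^3 / 6 * WB E Y
    + (h - \<kappa> * h^3 / 12) * WC K + h^3 / 12 * WC (K ** B)"
    unfolding energy_eq mixed_term Y_def[symmetric] by (simp add: algebra_simps)
  \<comment> \<open>What remains is 47/48 - 1/4 = 35/48 for \<open>E\<close> and 47/48 - 5/24 =
    37/48 for \<open>K\<close>.\<close>
  ultimately have "energy \<ge> 1 / 2 * (h * WS E) + 1 / 2 * (h * (c2 * (norm K)\<^sup>2))"
    by linarith
  then show "energy \<ge> h / 2 * WS E + h / 2 * c2 * (norm K)\<^sup>2"
    by (simp add: mult.assoc)
qed

lemma coercive_small_curvature: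
  assumes "h * k \<le> 1 / a" and a: "a \<ge> 1" "4 * a\<^sup>2 - 4 * a \<ge> 3 * (C1 / c1)"
  shows "energy \<ge> h / 2 * min c1 c2 * ((norm E)\<^sup>2 + (norm K)\<^sup>2)"
proof (rule half_bounds)
  define X where "X = F ** B - (2 * H) *\<^sub>R F"
  define q where "q = C1 / c1"
  have q: "q \<ge> 1" "C1 = q * c1"
    using c1_le_C1 c_pos by (simp_all add: q_def)
  have "a\<^sup>2 \<ge> 1"
    using a by simp
  define e where "e = (1 / a)\<^sup>2"
  \<comment> \<open>The last bound divides
    \<open>3 * q \<le> 4 * a\<^sup>2 - 4 * a \<le> 4 * a\<^sup>2\<close> by
    \<open>3 * a\<^sup>2\<close>.\<close>
  have e: "e > 0" "e \<le> 1" "q * e \<le> 4/3"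
    using a \<open>a\<^sup>2 \<ge> 1\<close> unfolding e_def q_def[symmetric] by (auto simp: power_divide field_simps)
  have kh: "\<bar>\<kappa> * h^3\<bar> \<le> h * e"
    unfolding e_def by (rule gauss_scaled[OF assms(1)])
  also have "h * e \<le> h * 1"
    using e h_pos by (intro mult_left_mono) auto
  finally have kh: "\<bar>\<kappa> * h^3\<bar> \<le> h" by simp
  have "WS X \<le> C1 * k\<^sup>2 * (norm F)\<^sup>2"
    unfolding X_def by (rule shell_shifted_le[OF F_normal])
  also have "\<dots> = q * k\<^sup>2 * (c1 * (norm F)\<^sup>2)"
    by (simp add: q)
  also have "\<dots> \<le> q * k\<^sup>2 * WS F"
    using q by (intro mult_left_mono shell_lower) auto
  finally have "h\<^sup>2 * WS X \<le> (h * k)\<^sup>2 * (q * WS F)"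
    using h_pos by (simp add: power_mult_distrib mult_ac)
  also have "\<dots> \<le> e * (q * WS F)"
    unfolding e_def using assms(1) h_pos k_nonneg WS_nonneg q by (intro mult_right_mono power_mono) auto
  finally have X: "h\<^sup>2 * WS X \<le> q * e * WS F"
    by (simp add: algebra_simps)
  \<comment> \<open>The weight is chosen so that the second term is at most \<open>WS F\<close>; the
    energy of \<open>F\<close>, which also has the coefficient \<open>h^3 / 12\<close>, then absorbs
    it completely.\<close>
  have "2 * WB E X \<ge> - (q * e / h\<^sup>2 * WS E + WS X / (q * e / h\<^sup>2))"
    using h_pos WS_nonneg q e by (intro W_shell_bilinear_young) auto
  moreover have "WS X / (q * e / h\<^sup>2) \<le> WS F"
    using X q e h_pos by (simp add: field_simps)
  ultimately have "2 * WB E X \<ge> - (q * e / h\<^sup>2 * WS E + WS F)"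
    by linarith
  then have "h^3 / 12 * (2 * WB E X) \<ge> h^3 / 12 * - (q * e / h\<^sup>2 * WS E + WS F)"
    using h_pos by (intro mult_left_mono) auto
  also have "h^3 / 12 * - (q * e / h\<^sup>2 * WS E + WS F) = - (q * e * (h * WS E) / 12 + h^3 / 12 * WS F)"
    using h_pos by (simp add: field_simps power2_eq_square power3_eq_cube)
  finally have "h^3 / 6 * WB E X \<ge> - (q * e * (h * WS E) / 12 + h^3 / 12 * WS F)"
    by simp
  moreover have "q * e * (h * WS E) \<le> 4 / 3 * (h * WS E)"
    using e h_pos WS_nonneg by (intro mult_right_mono) auto
  moreover have "(h + \<kappa> * h^3 / 12) * WS E \<ge> 11 / 12 * (h * WS E)"
    unfolding mult.assoc[symmetric]
    using kh WS_nonneg by (intro mult_right_mono) auto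
  moreover have "(h - \<kappa> * h^3 / 12) * WC K \<ge> 11 / 12 * (h * (c2 * (norm K)\<^sup>2))"
    unfolding mult.assoc[of _ h, symmetric]
    using kh curv_lower c_pos h_pos by (intro mult_mono) auto
  moreover have "h^3 / 12 * WC (K ** B) \<ge> 0" "h * WS E \<ge> 0" "h * (c2 * (norm K)\<^sup>2) \<ge> 0"
    using WS_nonneg WC_nonneg h_pos c_pos by auto
  moreover have "energy = (h + \<kappa> * h^3 / 12) * WS E + h^3 / 12 * WS F + h^3 / 6 * WB E X
    + (h - \<kappa> * h^3 / 12) * WC K + h^3 / 12 * WC (K ** B)"
    unfolding energy_eq X_def ..
  \<comment> \<open>What remains is 11/12 - (4/3)/12 = 29/36 for \<open>E\<close> and 11/12 for
    \<open>K\<close>.\<close>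
  ultimately have "energy \<ge> 1 / 2 * (h * WS E) + 1 / 2 * (h * (c2 * (norm K)\<^sup>2))"
    by linarith
  then show "energy \<ge> h / 2 * WS E + h / 2 * c2 * (norm K)\<^sup>2"
    by (simp add: mult.assoc)
qed

end

end

section \<open>Algebra of a surface frame\<close>

lemma append_column_mult: "append_column P v *v w = P *v vector [w$1, w$2] + w$3 *\<^sub>R v"
  by (simp add: append_column_def matrix_vector_mult_def vec_eq_iff sum_2 sum_3)

lemma append_column_axis_3: "append_column P v *v axis 3 1 = v"
  by (simp add: append_column_def matrix_vector_mult_def vec_eq_iff sum_3 axis_def)

lemma vector_split_2: "vector [u$1, u$2] = u" for u :: "'a::zero^2"
  by (simp add: vec_eq_iff forall_2)

lemma matrix_inv_cancel:
  fixes A :: "real^'n^'n"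
  assumes "invertible A"
  shows "A ** matrix_inv A = mat 1" "matrix_inv A ** A = mat 1"
  using someI_ex[OF assms[unfolded invertible_def]] by (auto simp: matrix_inv_def)

lemma invertible_iff_ker: "invertible A \<longleftrightarrow> (\<forall>x. A *v x = 0 \<longrightarrow> x = 0)" for A :: "real^'n^'n"
  using matrix_left_invertible_ker[of A] invertible_left_inverse[of A] by blast

lemma is_eigenvalue_iff_det: "is_eigenvalue A z \<longleftrightarrow> det (A - z *\<^sub>R mat 1) = 0" for A :: "real^'n^'n"
proof -
  have "is_eigenvalue A z \<longleftrightarrow> \<not> invertible (A - z *\<^sub>R mat 1)"
    unfolding is_eigenvalue_def invertible_iff_ker matrix_mult_shift(2) by auto
  then show ?thesis
    by (simp add: invertible_det_nz)
qed

lemma matrix_vector_mult_uminus: "(- A) *v v = - (A *v v)" for A :: "real^'n^'m"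
  by (simp add: vec_eq_iff matrix_vector_mult_def sum_negf)

lemma cayley_hamilton_2: "L *v (L *v u) = trace L *\<^sub>R (L *v u) - det L *\<^sub>R u" for L :: "real^2^2"
  by (simp add: vec_eq_iff forall_2 matrix_vector_mult_def sum_2 det_2 trace_def algebra_simps)

lemma symmetric_matrix_if_inner:
  fixes S :: "real^'n^'n"
  assumes "\<And>u w. (S *v u) \<bullet> w = u \<bullet> (S *v w)"
  shows "transpose S = S"
proof -
  have "S $ j $ i = S $ i $ j" for i j
    using assms[of "axis i 1" "axis j 1"]
    by (simp add: matrix_vector_mult_basis inner_axis inner_axis' column_def)
  then show ?thesis
    by (simp add: vec_eq_iff transpose_def)
qed

lemma norm_cross_le: "norm (cross3 x y) \<le> norm x * norm y"
proof (rule power2_le_imp_le)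
  show "(norm (cross3 x y))\<^sup>2 \<le> (norm x * norm y)\<^sup>2"
    using norm_cross_dot[of x y] by (metis le_add_same_cancel1 zero_le_power2)
qed simp

text \<open>
  A tangent frame \<open>P\<close> with unit normal \<open>n\<close>; \<open>N\<close> stands for the gradient of the normal field.
\<close>

locale surface_frame =
  fixes P N :: "real^2^3" and n :: "real^3"
  assumes unit: "norm n = 1" and tangent: "(P *v u) \<bullet> n = 0" and normal_derivative: "(N *v u) \<bullet> n = 0"
    and self_adjoint: "(P *v u) \<bullet> (N *v w) = (N *v u) \<bullet> (P *v w)"
    and regular: "det (append_column P n) \<noteq> 0"
begin

text \<open>\<open>G\<close>, \<open>L\<close>, \<open>shape\<close> and \<open>turn\<close> are
  \<open>grad_Theta0\<close>, \<open>weingarten\<close>, \<open>B_tensor\<close> and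
  \<open>C_tensor\<close> expressed through \<open>P\<close>, \<open>N\<close> and
  \<open>n\<close>.\<close>

definition "G = append_column P n"
definition "L = matrix_inv (transpose P ** P) ** (- (transpose P ** N))"
definition "shape = - (append_column N 0 ** matrix_inv G)"
definition "turn = det G *\<^sub>R (transpose (matrix_inv G) **
  vector [vector [0, 1, 0], vector [-1, 0, 0], vector [0, 0, 0]] ** matrix_inv G)"

lemma G_inv: "G ** matrix_inv G = mat 1" "matrix_inv G ** G = mat 1"
  using matrix_inv_cancel[of G] regular by (auto simp: G_def invertible_det_nz)

lemma G_mult: "G *v w = P *v vector [w$1, w$2] + w$3 *\<^sub>R n"
  by (simp add: G_def append_column_mult)

lemma G_axis_3: "G *v axis 3 1 = n"
  by (simp add: G_def append_column_axis_3)

lemma decompose: obtains u s where "v = P *v u + s *\<^sub>R n"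
proof
  have "v = G *v (matrix_inv G *v v)"
    by (simp add: matrix_vector_mul_assoc G_inv)
  then show "v = P *v vector [(matrix_inv G *v v)$1, (matrix_inv G *v v)$2] + (matrix_inv G *v v)$3 *\<^sub>R n"
    by (simp add: G_mult)
qed

lemma P_injective:
  assumes "P *v u = 0" shows "u = 0"
proof -
  have "invertible G"
    using regular by (simp add: invertible_det_nz G_def)
  moreover have "G *v vector [u$1, u$2, 0] = 0"
    using assms by (simp add: G_mult vector_split_2)
  ultimately have "vector [u$1, u$2, 0] = (0 :: real^3)"
    unfolding invertible_iff_ker by blast
  then have "u$1 = 0" "u$2 = 0"
    by (metis vector_3(1) zero_index, metis vector_3(2) zero_index)
  then show ?thesis
    by (simp add: vec_eq_iff forall_2)
qed

lemma transpose_mult_zero_iff: "transpose A *v v = 0 \<longleftrightarrow> (\<forall>u. (A *v u) \<bullet> v = 0)" for A :: "real^'n^'m"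
  by (metis dot_lmul_matrix inner_commute inner_eq_zero_iff inner_zero_right vector_transpose_matrix)

text \<open>The Weingarten equations. By the choice of \<open>L\<close>, the sum of both sides'
  tangential terms, \<open>P *v (L *v u) + N *v u\<close>, is orthogonal to all tangent vectors; it
  is also orthogonal to \<open>n\<close>, and these span the space.\<close>

lemma N_eq: "N *v u = - (P *v (L *v u))"
proof -
  have "invertible (transpose P ** P)"
    unfolding invertible_iff_ker
  proof (intro allI impI)
    fix u assume "(transpose P ** P) *v u = 0"
    then have "(P *v u) \<bullet> (P *v u) = 0"
      using transpose_mult_zero_iff[of P "P *v u"] by (simp add: matrix_vector_mul_assoc)
    then show "u = 0"
      by (intro P_injective) simp
  qed
  then have "(transpose P ** P) *v (L *v u) = - (transpose P ** N) *v u"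
    unfolding L_def matrix_vector_mul_assoc
    by (metis matrix_inv_cancel(1) matrix_mul_assoc matrix_mul_lid)
  then have "transpose P *v (P *v (L *v u) + N *v u) = 0"
    by (simp add: matrix_vector_right_distrib matrix_vector_mul_assoc matrix_mul_assoc matrix_vector_mult_uminus)
  then have tangential: "(P *v w) \<bullet> (P *v (L *v u) + N *v u) = 0" for w
    using transpose_mult_zero_iff[of P] by blast
  have normal: "(P *v (L *v u) + N *v u) \<bullet> n = 0"
    by (simp add: inner_add_left tangent normal_derivative)
  obtain w s where w: "P *v (L *v u) + N *v u = P *v w + s *\<^sub>R n"
    using decompose .
  have "(P *v (L *v u) + N *v u) \<bullet> (P *v (L *v u) + N *v u) = 0"
    by (subst (1) w) (use normal in \<open>simp add: inner_add_left tangential inner_commute[of n]\<close>)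
  then show ?thesis
    by (simp add: eq_neg_iff_add_eq_0 add.commute)
qed

text \<open>\<open>G\<close> maps the coordinates \<open>(u, s)\<close> to
  \<open>P *v u + s *\<^sub>R n\<close>, so its inverse reads them off, and the zero column in
  \<open>shape\<close> discards \<open>s\<close>.\<close>

lemma shape_tangential: "shape *v (P *v u + s *\<^sub>R n) = P *v (L *v u)"
proof -
  have "P *v u + s *\<^sub>R n = G *v vector [u$1, u$2, s]"
    by (simp add: G_mult vector_split_2)
  then have "matrix_inv G *v (P *v u + s *\<^sub>R n) = vector [u$1, u$2, s]"
    by (simp add: matrix_vector_mul_assoc G_inv)
  then show ?thesis
    by (simp add: shape_def matrix_vector_mult_uminus matrix_vector_mul_assoc[symmetric]
        append_column_mult vector_split_2 N_eq)
qed

lemma shape_symmetric: "transpose shape = shape"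
proof (rule symmetric_matrix_if_inner)
  fix v w
  obtain u s u' s' where v: "v = P *v u + s *\<^sub>R n" and w: "w = P *v u' + s' *\<^sub>R n"
    using decompose by metis
  show "(shape *v v) \<bullet> w = v \<bullet> (shape *v w)"
    unfolding v w shape_tangential
    using self_adjoint[of u u'] tangent
    by (simp add: N_eq inner_add_left inner_add_right inner_commute[of n])
qed

lemma tangent_vector:
  assumes "v \<bullet> n = 0" obtains u where "v = P *v u"
proof -
  obtain u s where v: "v = P *v u + s *\<^sub>R n"
    using decompose .
  have "n \<bullet> n = 1"
    using unit by (simp add: norm_eq_1)
  with assms have "s = 0"
    by (simp add: v inner_add_left tangent)
  then show ?thesis
    using v that by simp
qed

lemma shape_P: "shape *v (P *v u) = P *v (L *v u)"
  using shape_tangential[of u 0] by simp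

text \<open>The middle factor of \<open>turn\<close> is the cross product with the third axis from
  the right. The transformation rule of the cross product under \<open>G\<close>, which maps that
  axis to \<open>n\<close>, cancels the determinant and the inverses.\<close>

lemma turn_mult: "turn *v v = cross3 v n"
proof -
  define w where "w = matrix_inv G *v v"
  have v: "G *v w = v"
    by (simp add: w_def matrix_vector_mul_assoc G_inv)
  have J: "vector [vector [0, 1, 0], vector [-1, 0, 0], vector [0, 0, 0]] *v w = cross3 w (axis 3 1)"
    by (simp add: matrix_vector_mult_def vec_eq_iff forall_3 sum_3 cross3_def axis_def)
  have "turn *v v = transpose (matrix_inv G) *v (det G *\<^sub>R cross3 w (axis 3 1))"
    by (simp add: turn_def scaleR_matrix_vector_assoc[symmetric] matrix_vector_mul_assoc[symmetric]
        w_def[symmetric] J matrix_vector_mult_scaleR)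
  also have "det G *\<^sub>R cross3 w (axis 3 1) = transpose G *v cross3 v n"
    using cross_matrix_mult[of G w "axis 3 1"] by (simp add: v G_axis_3)
  also have "transpose (matrix_inv G) *v (transpose G *v cross3 v n) = cross3 v n"
    by (simp add: vector_matrix_mul_assoc G_inv)
  finally show ?thesis .
qed

lemma curved_shell:
  assumes "\<And>z. is_eigenvalue L z \<Longrightarrow> \<bar>z\<bar> \<le> k"
  shows "curved_shell shape turn n (trace L / 2) (det L) k"
proof
  show "transpose shape = shape"
    by (rule shape_symmetric)
  show "shape *v n = 0"
    using shape_tangential[of 0 1] by simp
  show "norm (turn *v v) \<le> norm v" for v
    using norm_cross_le[of v n] by (simp add: turn_mult unit)
  have "shape *v (shape *v (P *v u)) = trace L *\<^sub>R (shape *v (P *v u)) - det L *\<^sub>R (P *v u)" for u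
    by (simp add: shape_P) (simp add: cayley_hamilton_2 matrix_vector_mult_diff_distrib matrix_vector_mult_scaleR)
  then show ch: "shape *v (shape *v v) = (2 * (trace L / 2)) *\<^sub>R (shape *v v) - det L *\<^sub>R v"
    if "v \<bullet> n = 0" for v
    using tangent_vector[OF that] by auto
  have det_eq: "det (L - z *\<^sub>R mat 1) = z\<^sup>2 - trace L * z + det L" for z
    by (simp add: det_2 trace_def sum_2 mat_def power2_eq_square algebra_simps)
  then show roots: "\<bar>z\<bar> \<le> k" if "z\<^sup>2 - 2 * (trace L / 2) * z + det L = 0" for z
    using that assms[of z] by (simp add: is_eigenvalue_iff_det)
  \<comment> \<open>The property \<open>roots\<close> would be vacuous for a polynomial without real
    roots. A nonzero tangent vector and the symmetry of \<open>shape\<close> show that the roots are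
    real, hence the bounds on \<open>det L\<close> and \<open>k\<close>.\<close>
  define v where "v = P *v axis 1 1"
  have "v \<noteq> 0" "v \<bullet> n = 0"
    using P_injective[of "axis 1 1"] tangent by (auto simp: v_def axis_eq_0_iff)
  note v = symmetric_quadratic_roots[OF shape_symmetric ch[OF this(2)] this(1) roots]
    symmetric_quadratic_product_le[OF shape_symmetric ch[OF this(2)] this(1) roots]
  show "\<bar>det L\<bar> \<le> k\<^sup>2"
    using v(3) .
  show "0 \<le> k"
    using v(1,2) by (meson abs_ge_zero add_nonneg_nonneg divide_nonneg_nonneg order_trans real_sqrt_ge_zero zero_le_numeral)
qed

end

section \<open>Differentiation\<close>

text \<open>The mean value theorem along \<open>u\<close> turns the second difference into
  \<open>t\<close> times a difference of \<open>g' _ u\<close> at two points near \<open>a\<close>.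
  Differentiability of \<open>g' _ u\<close> at \<open>a\<close> evaluates the latter up to
  \<open>o(t)\<close>.\<close>

lemma second_derivative_increment:
  fixes g :: "'a::real_normed_vector \<Rightarrow> real"
  assumes "open S" "a \<in> S" and g': "\<And>x. x \<in> S \<Longrightarrow> (g has_derivative g' x) (at x)"
    and D: "((\<lambda>x. g' x u) has_derivative D) (at a)" and "\<epsilon> > 0"
  shows "\<exists>\<delta>>0. \<forall>t. 0 < t \<longrightarrow> t < \<delta> \<longrightarrow>
    \<bar>g (a + t *\<^sub>R u + t *\<^sub>R v) - g (a + t *\<^sub>R u) - g (a + t *\<^sub>R v) + g a - t\<^sup>2 * D v\<bar> \<le> \<epsilon> * t\<^sup>2"
proof -
  obtain r where "r > 0" and r: "ball a r \<subseteq> S"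
    using assms(1,2) open_contains_ball by blast
  \<comment> \<open>All points of the parallelogram with sides \<open>t *\<^sub>R u\<close> and
    \<open>t *\<^sub>R v\<close> lie within \<open>t * M\<close> of \<open>a\<close>; the summand 1
    keeps \<open>M\<close> positive.\<close>
  define M where "M = norm u + norm v + 1"
  have "M > 0"
    by (simp add: M_def add_nonneg_pos)
  interpret D: bounded_linear D
    using D by (rule has_derivative_bounded_linear)
  \<comment> \<open>With this tolerance each of the two evaluation points contributes an error of at
    most \<open>\<epsilon> * t / 2\<close>.\<close>
  have "\<epsilon> / (2 * M) > 0"
    using \<open>\<epsilon> > 0\<close> \<open>M > 0\<close> by simp
  then obtain d where "d > 0"
    and d: "\<And>y. norm (y - a) < d \<Longrightarrow> \<bar>g' y u - g' a u - D (y - a)\<bar> \<le> \<epsilon> / (2 * M) * norm (y - a)"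
    using D unfolding has_derivative_at_alt real_norm_def by blast
  show ?thesis
  proof (intro exI conjI allI impI)
    show "min r d / M > 0"
      using \<open>r > 0\<close> \<open>d > 0\<close> \<open>M > 0\<close> by simp
    fix t assume "0 < t" "t < min r d / M"
    then have tM: "t * M < r" "t * M < d"
      using \<open>M > 0\<close> by (simp_all add: pos_less_divide_eq)
    have near: "norm (s *\<^sub>R u + q *\<^sub>R v) \<le> t * M" if "0 \<le> s" "s \<le> t" "0 \<le> q" "q \<le> t" for s q
    proof -
      have "norm (s *\<^sub>R u + q *\<^sub>R v) \<le> s * norm u + q * norm v"
        using norm_triangle_ineq[of "s *\<^sub>R u" "q *\<^sub>R v"] that by simp
      also have "\<dots> \<le> t * norm u + t * norm v"
        using that by (intro add_mono mult_right_mono) auto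
      also have "\<dots> \<le> t * M"
        using \<open>0 < t\<close> by (simp add: M_def algebra_simps)
      finally show ?thesis .
    qed
    have inS: "a + s *\<^sub>R u + q *\<^sub>R v \<in> S" if "0 \<le> s" "s \<le> t" "0 \<le> q" "q \<le> t" for s q
    proof -
      have "dist (a + (s *\<^sub>R u + q *\<^sub>R v)) a < r"
        using near[OF that] tM by (simp add: dist_norm)
      then have "a + (s *\<^sub>R u + q *\<^sub>R v) \<in> ball a r"
        by (simp add: dist_commute)
      then show ?thesis
        using r by (auto simp: add.assoc)
    qed
    define \<phi> where "\<phi> = (\<lambda>s. g (a + s *\<^sub>R u + t *\<^sub>R v) - g (a + s *\<^sub>R u))"
    have line: "((\<lambda>s. g (a + s *\<^sub>R u + q *\<^sub>R v)) has_real_derivative g' (a + s *\<^sub>R u + q *\<^sub>R v) u) (at s)"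
      if "0 \<le> s" "s \<le> t" "0 \<le> q" "q \<le> t" for s q
    proof -
      let ?p = "\<lambda>s. a + s *\<^sub>R u + q *\<^sub>R v"
      have "(?p has_derivative (\<lambda>s. s *\<^sub>R u)) (at s)"
        by (auto intro!: derivative_eq_intros)
      from has_derivative_compose[OF this g'[OF inS[OF that]]]
      have "((\<lambda>s. g (?p s)) has_derivative (\<lambda>c. g' (?p s) (c *\<^sub>R u))) (at s)" .
      moreover have "g' (?p s) (c *\<^sub>R u) = g' (?p s) u * c" for c
        using has_derivative_bounded_linear[OF g'[OF inS[OF that]]]
        by (simp add: bounded_linear.linear linear_scale mult.commute)
      ultimately show ?thesis
        by (simp add: has_field_derivative_def)
    qed
    have "(\<phi> has_real_derivative g' (a + s *\<^sub>R u + t *\<^sub>R v) u - g' (a + s *\<^sub>R u) u) (at s)"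
      if "0 \<le> s" "s \<le> t" for s
      unfolding \<phi>_def using line[of s t] line[of s 0] that \<open>0 < t\<close> by (auto intro: DERIV_diff)
    then obtain s where s: "0 < s" "s < t"
      and mvt: "\<phi> t - \<phi> 0 = (t - 0) * (g' (a + s *\<^sub>R u + t *\<^sub>R v) u - g' (a + s *\<^sub>R u) u)"
      using MVT2[OF \<open>0 < t\<close>, of \<phi> "\<lambda>s. g' (a + s *\<^sub>R u + t *\<^sub>R v) u - g' (a + s *\<^sub>R u) u"] by blast
    have close: "\<bar>g' (a + (s *\<^sub>R u + q *\<^sub>R v)) u - g' a u - D (s *\<^sub>R u + q *\<^sub>R v)\<bar> \<le> \<epsilon> * t / 2"
      if "0 \<le> q" "q \<le> t" for q
    proof -
      have n: "norm (s *\<^sub>R u + q *\<^sub>R v) \<le> t * M"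
        using near s that by simp
      have "\<bar>g' (a + (s *\<^sub>R u + q *\<^sub>R v)) u - g' a u - D (s *\<^sub>R u + q *\<^sub>R v)\<bar>
          \<le> \<epsilon> / (2 * M) * norm (s *\<^sub>R u + q *\<^sub>R v)"
        using d[of "a + (s *\<^sub>R u + q *\<^sub>R v)"] n tM by simp
      also have "\<dots> \<le> \<epsilon> / (2 * M) * (t * M)"
        using n \<open>\<epsilon> / (2 * M) > 0\<close> by (intro mult_left_mono) auto
      also have "\<dots> = \<epsilon> * t / 2"
        using \<open>M > 0\<close> by simp
      finally show ?thesis .
    qed
    have "\<bar>g' (a + s *\<^sub>R u + t *\<^sub>R v) u - g' (a + s *\<^sub>R u) u - t * D v\<bar> \<le> \<epsilon> * t"
    proof -
      have "\<bar>g' (a + (s *\<^sub>R u + t *\<^sub>R v)) u - g' a u - (s * D u + t * D v)\<bar> \<le> \<epsilon> * t / 2"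
        "\<bar>g' (a + s *\<^sub>R u) u - g' a u - s * D u\<bar> \<le> \<epsilon> * t / 2"
        using close[of t] close[of 0] \<open>0 < t\<close> by (simp_all add: D.add D.scaleR)
      then show ?thesis
        unfolding add.assoc by linarith
    qed
    then have "t * \<bar>g' (a + s *\<^sub>R u + t *\<^sub>R v) u - g' (a + s *\<^sub>R u) u - t * D v\<bar> \<le> t * (\<epsilon> * t)"
      using \<open>0 < t\<close> by (intro mult_left_mono) auto
    moreover have "\<bar>\<phi> t - \<phi> 0 - t\<^sup>2 * D v\<bar> = \<bar>t * (g' (a + s *\<^sub>R u + t *\<^sub>R v) u - g' (a + s *\<^sub>R u) u - t * D v)\<bar>"
      unfolding mvt by (simp add: algebra_simps power2_eq_square)
    ultimately have "\<bar>\<phi> t - \<phi> 0 - t\<^sup>2 * D v\<bar> \<le> \<epsilon> * t\<^sup>2"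
      using \<open>0 < t\<close> by (simp add: abs_mult power2_eq_square mult_ac)
    then show "\<bar>g (a + t *\<^sub>R u + t *\<^sub>R v) - g (a + t *\<^sub>R u) - g (a + t *\<^sub>R v) + g a - t\<^sup>2 * D v\<bar> \<le> \<epsilon> * t\<^sup>2"
      by (simp add: \<phi>_def algebra_simps)
  qed
qed

text \<open>The second difference is symmetric in \<open>u\<close> and \<open>v\<close>, but is
  approximated both by \<open>t\<^sup>2 * Du v\<close> and by
  \<open>t\<^sup>2 * Dv u\<close>.\<close>

lemma symmetric_second_derivative:
  fixes g :: "'a::real_normed_vector \<Rightarrow> real"
  assumes "open S" "a \<in> S" and g': "\<And>x. x \<in> S \<Longrightarrow> (g has_derivative g' x) (at x)"
    and Du: "((\<lambda>x. g' x u) has_derivative Du) (at a)"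
    and Dv: "((\<lambda>x. g' x v) has_derivative Dv) (at a)"
  shows "Du v = Dv u"
proof (rule ccontr)
  assume "Du v \<noteq> Dv u"
  \<comment> \<open>With a quarter of the gap, the two errors together reach only half of
    it.\<close>
  define \<epsilon> where "\<epsilon> = \<bar>Du v - Dv u\<bar> / 4"
  have "\<epsilon> > 0"
    using \<open>Du v \<noteq> Dv u\<close> by (simp add: \<epsilon>_def)
  let ?\<Delta> = "\<lambda>t. g (a + t *\<^sub>R u + t *\<^sub>R v) - g (a + t *\<^sub>R u) - g (a + t *\<^sub>R v) + g a"
  obtain d e where "d > 0" "e > 0"
    and u: "\<And>t. 0 < t \<Longrightarrow> t < d \<Longrightarrow> \<bar>?\<Delta> t - t\<^sup>2 * Du v\<bar> \<le> \<epsilon> * t\<^sup>2"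
    and v: "\<And>t. 0 < t \<Longrightarrow> t < e \<Longrightarrow> \<bar>g (a + t *\<^sub>R v + t *\<^sub>R u) - g (a + t *\<^sub>R v) - g (a + t *\<^sub>R u) + g a - t\<^sup>2 * Dv u\<bar> \<le> \<epsilon> * t\<^sup>2"
    using second_derivative_increment[OF assms(1-3) Du \<open>\<epsilon> > 0\<close>, of v]
      second_derivative_increment[OF assms(1-3) Dv \<open>\<epsilon> > 0\<close>, of u] by blast
  define t where "t = min d e / 2"
  have t: "0 < t" "t < d" "t < e"
    using \<open>d > 0\<close> \<open>e > 0\<close> by (auto simp: t_def)
  have "\<bar>?\<Delta> t - t\<^sup>2 * Dv u\<bar> \<le> \<epsilon> * t\<^sup>2"
    using v[OF t(1,3)] by (simp add: add.assoc add.commute[of "t *\<^sub>R u"])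
  with u[OF t(1,2)] have "\<bar>t\<^sup>2 * Du v - t\<^sup>2 * Dv u\<bar> \<le> 2 * (\<epsilon> * t\<^sup>2)"
    by linarith
  then have "t\<^sup>2 * \<bar>Du v - Dv u\<bar> \<le> t\<^sup>2 * (2 * \<epsilon>)"
    unfolding right_diff_distrib[symmetric] abs_mult by (simp add: mult_ac)
  then have "\<bar>Du v - Dv u\<bar> \<le> 2 * \<epsilon>"
    using t by simp
  then show False
    using \<open>\<epsilon> > 0\<close> by (simp add: \<epsilon>_def)
qed

section \<open>Gradients and derivatives of diffeomorphisms\<close>

lemma partial_eq:
  assumes "(f has_derivative D) (at x)"
  shows "partial j f x = D (axis j 1)"
proof -
  have "((\<lambda>t. x + t *\<^sub>R axis j 1) has_derivative (\<lambda>t. t *\<^sub>R axis j 1)) (at 0)"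
    by (auto intro!: derivative_eq_intros)
  moreover have "(f has_derivative D) (at (x + 0 *\<^sub>R axis j 1))"
    using assms by simp
  ultimately have "((\<lambda>t. f (x + t *\<^sub>R axis j 1)) has_derivative (\<lambda>t. D (t *\<^sub>R axis j 1))) (at 0)"
    by (rule has_derivative_compose)
  moreover have "D (t *\<^sub>R axis j 1) = t *\<^sub>R D (axis j 1)" for t
    using has_derivative_bounded_linear[OF assms] by (simp add: bounded_linear.linear linear_scale)
  ultimately show ?thesis
    unfolding partial_def has_vector_derivative_def[symmetric]
    by (simp add: has_vector_derivative_def vector_derivative_at)
qed

lemma grad_eq_matrix:
  assumes "(f has_derivative D) (at x)"
  shows "grad f x = matrix D"
  by (simp add: grad_def matrix_def partial_eq[OF assms])

lemma grad_mult:
  assumes "(f has_derivative D) (at x)"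
  shows "grad f x *v w = D w"
  unfolding grad_eq_matrix[OF assms]
  by (rule fun_cong[OF matrix_vector_mul(3)[OF has_derivative_bounded_linear[OF assms]]])

text \<open>On the open image, \<open>f\<close> after its inverse is the identity, so by the chain
  rule \<open>D\<close> has a right inverse.\<close>

lemma C1_diffeo_has_derivative:
  assumes "C1_diffeo_onto_image S f" "X \<in> S"
  obtains D where "(f has_derivative D) (at X)" "surj D"
proof -
  obtain D where D: "(f has_derivative D) (at X)"
    using assms unfolding C1_diffeo_onto_image_def C1_map_def by blast
  obtain D' where D': "(inv_into S f has_derivative D') (at (f X))"
    using assms unfolding C1_diffeo_onto_image_def C1_map_def by blast
  have "inv_into S f (f X) = X"
    using assms by (simp add: C1_diffeo_onto_image_def)
  then have "((\<lambda>y. f (inv_into S f y)) has_derivative (\<lambda>y. D (D' y))) (at (f X))"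
    by (intro has_derivative_compose[OF D']) (simp add: D)
  then have "((\<lambda>y. y) has_derivative (\<lambda>y. D (D' y))) (at (f X))"
    by (rule has_derivative_transform_within_open[of _ _ _ _ "f ` S"])
      (use assms in \<open>auto simp: C1_diffeo_onto_image_def f_inv_into_f\<close>)
  then have "(\<lambda>y. D (D' y)) = (\<lambda>y. y)"
    by (rule has_derivative_unique) (rule has_derivative_ident)
  then have "surj D"
    by (metis surjI)
  with D show ?thesis
    by (rule that)
qed

section \<open>The shell\<close>

lemma reference_configuration_regular:
  assumes "reference_configuration \<omega> h y0" "x \<in> \<omega>"
  shows "det (grad_Theta0 y0 x) \<noteq> 0"
proof -
  have "vector [x$1, x$2, 0] \<in> plate \<omega> h"
    using assms by (simp add: plate_def reference_configuration_def vector_split_2)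
  then obtain D where D: "(Theta y0 has_derivative D) (at (vector [x$1, x$2, 0]))" "surj D"
    using C1_diffeo_has_derivative assms(1) unfolding reference_configuration_def by blast
  have "(*v) (grad_Theta0 y0 x) = D"
    unfolding grad_Theta0_def by (rule ext) (rule grad_mult[OF D(1)])
  then have "invertible (grad_Theta0 y0 x)"
    unfolding invertible_right_inverse matrix_right_invertible_surjective using D(2) by simp
  then show ?thesis
    by (simp add: invertible_det_nz)
qed

text \<open>Differentiating \<open>n \<bullet> n = 1\<close> makes the derivative of the normal
  tangential. Differentiating \<open>y' u \<bullet> n = 0\<close> expresses the second fundamental
  form by second derivatives of \<open>y0\<close>, whose symmetry gives
  \<open>self_adjoint\<close>.\<close>

lemma reference_configuration_frame:
  assumes ref: "reference_configuration \<omega> h y0" and x: "x \<in> \<omega>"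
  shows "surface_frame (grad y0 x) (grad (unit_normal y0) x) (unit_normal y0 x)"
proof -
  have "open \<omega>"
    using ref by (simp add: reference_configuration_def lipschitz_domain_def)
  obtain y' :: "real^2 \<Rightarrow> (real^2) \<Rightarrow>\<^sub>L (real^3)"
    and y'' :: "real^2 \<Rightarrow> (real^2) \<Rightarrow>\<^sub>L (real^2) \<Rightarrow>\<^sub>L (real^3)"
    where y': "\<And>y. y \<in> \<omega> \<Longrightarrow> (y0 has_derivative y' y) (at y)"
      and y'': "\<And>y. y \<in> \<omega> \<Longrightarrow> (y' has_derivative y'' y) (at y)"
    using ref unfolding reference_configuration_def C2_map_def C1_map_def by blast
  define n where "n = unit_normal y0"
  define N where "N = (\<lambda>y. cross3 (y' y (axis 1 1)) (y' y (axis 2 1)))"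
  have n: "n y = (1 / norm (N y)) *\<^sub>R N y" if "y \<in> \<omega>" for y
    by (simp add: n_def unit_normal_def Let_def N_def partial_eq[OF y'[OF that]])
  have grad_y: "grad y0 y *v u = y' y u" if "y \<in> \<omega>" for y u
    by (rule grad_mult) (rule y'[OF that])
  have y'_split: "y' y u = u$1 *\<^sub>R y' y (axis 1 1) + u$2 *\<^sub>R y' y (axis 2 1)" for y u
  proof -
    have "u = u$1 *\<^sub>R axis 1 1 + u$2 *\<^sub>R axis 2 1"
      by (simp add: vec_eq_iff forall_2 axis_def)
    then show ?thesis
      by (metis blinfun.add_right blinfun.scaleR_right)
  qed
  \<comment> \<open>If the cross product vanished, so would \<open>unit_normal\<close>, and
    \<open>grad_Theta0\<close> would be singular with a zero third column.\<close>
  have N_nonzero: "N y \<noteq> 0" if "y \<in> \<omega>" for y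
  proof
    assume "N y = 0"
    then have "n y = 0"
      using n[OF that] by simp
    then have "append_column (grad y0 y) (n y) *v axis 3 1 = 0"
      by (simp add: append_column_axis_3)
    moreover have "invertible (append_column (grad y0 y) (n y))"
      using reference_configuration_regular[OF ref that]
      by (simp add: grad_Theta0_eq n_def invertible_det_nz)
    ultimately have "axis 3 1 = (0 :: real^3)"
      unfolding invertible_iff_ker by blast
    then show False
      by (simp add: axis_eq_0_iff)
  qed
  have norm_n: "norm (n y) = 1" if "y \<in> \<omega>" for y
    using N_nonzero[OF that] by (simp add: n[OF that])
  have tangent: "y' y u \<bullet> n y = 0" if "y \<in> \<omega>" for y u
    unfolding y'_split[of y u] n[OF that] N_def by (simp add: inner_add_left dot_cross_self)
  have dir: "((\<lambda>y. y' y u) has_derivative (\<lambda>w. y'' x w u)) (at x)" for u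
    using y''[OF x] by (rule bounded_linear.has_derivative[OF blinfun.bounded_linear_left])
  have "bounded_bilinear cross3"
    using bilinear_cross bilinear_conv_bounded_bilinear by blast
  then have "(N has_derivative (\<lambda>w. cross3 (y' x (axis 1 1)) (y'' x w (axis 2 1))
      + cross3 (y'' x w (axis 1 1)) (y' x (axis 2 1)))) (at x)"
    unfolding N_def by (rule bounded_bilinear.FDERIV) (rule dir)+
  then have "N differentiable (at x)"
    by (rule differentiableI)
  moreover from this have "(\<lambda>y. norm (N y)) differentiable (at x)"
    using differentiable_compose[of norm N x UNIV] differentiable_norm_at[OF N_nonzero[OF x]] by simp
  ultimately have "(\<lambda>y. (1 / norm (N y)) *\<^sub>R N y) differentiable (at x)"
    using N_nonzero[OF x] by (intro differentiable_scaleR differentiable_divide) auto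
  then obtain n' where "((\<lambda>y. (1 / norm (N y)) *\<^sub>R N y) has_derivative n') (at x)"
    unfolding differentiable_def by blast
  then have n': "(n has_derivative n') (at x)"
    by (rule has_derivative_transform_within_open[OF _ \<open>open \<omega>\<close> x]) (simp add: n)
  have grad_n: "grad (unit_normal y0) x *v u = n' u" for u
    using grad_mult[OF n'] by (simp add: n_def)
  have zero_derivative: "d = (\<lambda>w. 0)" if "(g has_derivative d) (at x)" "\<And>y. y \<in> \<omega> \<Longrightarrow> g y = c"
    for g :: "real^2 \<Rightarrow> real" and d c
  proof -
    have "((\<lambda>y. c) has_derivative d) (at x)"
      using that(1) by (rule has_derivative_transform_within_open[OF _ \<open>open \<omega>\<close> x]) (rule that(2))
    then show ?thesis
      by (rule has_derivative_unique) (rule has_derivative_const)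
  qed
  have "((\<lambda>y. n y \<bullet> n y) has_derivative (\<lambda>w. n x \<bullet> n' w + n' w \<bullet> n x)) (at x)"
    using n' n' by (rule has_derivative_inner)
  then have "(\<lambda>w. n x \<bullet> n' w + n' w \<bullet> n x) = (\<lambda>w. 0)"
    by (rule zero_derivative[where c = 1]) (use norm_n in \<open>simp add: norm_eq_1\<close>)
  then have "n x \<bullet> n' w + n' w \<bullet> n x = 0" for w
    by (rule fun_cong)
  then have n'_normal: "n' w \<bullet> n x = 0" for w
    by (simp add: inner_commute)
  have second: "y' x u \<bullet> n' w = - (y'' x w u \<bullet> n x)" for u w
  proof -
    have "((\<lambda>y. y' y u \<bullet> n y) has_derivative (\<lambda>w. y' x u \<bullet> n' w + y'' x w u \<bullet> n x)) (at x)"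
      using dir n' by (rule has_derivative_inner)
    then have "(\<lambda>w. y' x u \<bullet> n' w + y'' x w u \<bullet> n x) = (\<lambda>w. 0)"
      by (rule zero_derivative[where c = 0]) (rule tangent)
    then have "y' x u \<bullet> n' w + y'' x w u \<bullet> n x = 0"
      by (rule fun_cong)
    then show ?thesis
      by linarith
  qed
  \<comment> \<open>Freezing the normal at \<open>x\<close> leaves a scalar function of
    \<open>y\<close>, to which the symmetry of second derivatives applies.\<close>
  have schwarz: "y'' x w u \<bullet> n x = y'' x u w \<bullet> n x" for u w
  proof (rule symmetric_second_derivative[OF \<open>open \<omega>\<close> x, where g = "\<lambda>y. y0 y \<bullet> n x"
        and g' = "\<lambda>y v. y' y v \<bullet> n x" and Du = "\<lambda>v. y'' x v u \<bullet> n x"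
        and Dv = "\<lambda>v. y'' x v w \<bullet> n x"])
    show "((\<lambda>y. y0 y \<bullet> n x) has_derivative (\<lambda>w. y' y w \<bullet> n x)) (at y)" if "y \<in> \<omega>" for y
      using y'[OF that] by (rule has_derivative_inner_left)
    show "((\<lambda>y. y' y u \<bullet> n x) has_derivative (\<lambda>v. y'' x v u \<bullet> n x)) (at x)"
      "((\<lambda>y. y' y w \<bullet> n x) has_derivative (\<lambda>v. y'' x v w \<bullet> n x)) (at x)"
      using dir by (rule has_derivative_inner_left)+
  qed
  show ?thesis
    unfolding n_def[symmetric]
  proof
    show "norm (n x) = 1"
      by (rule norm_n[OF x])
    show "(grad y0 x *v u) \<bullet> n x = 0" for u
      by (simp add: grad_y[OF x] tangent[OF x])
    show "(grad n x *v u) \<bullet> n x = 0" for u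
      using n'_normal by (simp add: grad_n n_def)
    show "(grad y0 x *v u) \<bullet> (grad n x *v w) = (grad n x *v u) \<bullet> (grad y0 x *v w)" for u w
      using second[of u w] second[of w u] schwarz[of u w]
      by (simp add: grad_y[OF x] grad_n n_def inner_commute[of "n' u"])
    show "det (append_column (grad y0 x) (n x)) \<noteq> 0"
      using reference_configuration_regular[OF ref x] by (simp add: grad_Theta0_eq n_def)
  qed
qed

lemma reference_configuration_curved_shell:
  assumes "reference_configuration \<omega> h y0" "x \<in> \<omega>"
    and "\<And>z. z \<in> principal_curvatures y0 x \<Longrightarrow> \<bar>z\<bar> \<le> k"
  shows "curved_shell (B_tensor y0 x) (C_tensor y0 x) (unit_normal y0 x)
    (mean_curvature y0 x) (gauss_curvature y0 x) k"
proof -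
  interpret surface_frame "grad y0 x" "grad (unit_normal y0) x" "unit_normal y0 x"
    using assms(1,2) by (rule reference_configuration_frame)
  have G: "G = grad_Theta0 y0 x"
    by (simp add: G_def grad_Theta0_eq)
  have L: "L = weingarten y0 x"
    by (simp add: L_def weingarten_def first_form_def second_form_def)
  have "B_tensor y0 x = shape" "C_tensor y0 x = turn"
    by (simp_all add: B_tensor_def C_tensor_def shape_def turn_def G)
  then show ?thesis
    using curved_shell[of k] assms(3)
    by (simp add: mean_curvature_def gauss_curvature_def L principal_curvatures_def)
qed

text \<open>The inverse of \<open>grad_Theta0\<close> sends the normal to the third axis, so only
  third columns count: the shell strain gives \<open>Q\<^sup>T Q n - n\<close>, and the third column
  of the curvature is zero.\<close>

lemma strain_normal:
  assumes "reference_configuration \<omega> h y0" "x \<in> \<omega>" "rotation_matrix (Q x)"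
  shows "shell_strain y0 m Q x *v unit_normal y0 x = 0"
    and "bending_curvature y0 Q x *v unit_normal y0 x = 0"
proof -
  interpret surface_frame "grad y0 x" "grad (unit_normal y0) x" "unit_normal y0 x"
    using assms(1,2) by (rule reference_configuration_frame)
  have G: "grad_Theta0 y0 x = G"
    by (simp add: G_def grad_Theta0_eq)
  have inv: "matrix_inv G *v unit_normal y0 x = axis 3 1"
    by (metis G_axis_3 G_inv(2) matrix_vector_mul_assoc matrix_vector_mul_lid)
  have columns: "columns3 a b 0 *v axis 3 1 = 0" for a b
    by (simp add: columns3_def matrix_vector_mult_def vec_eq_iff sum_3 axis_def)
  have "transpose (Q x) ** Q x = mat 1"
    using assms(3) by (simp add: rotation_matrix_def orthogonal_matrix_def)
  then have "transpose (Q x) *v (Q x *v unit_normal y0 x) = unit_normal y0 x"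
    by (metis matrix_vector_mul_assoc matrix_vector_mul_lid)
  then show "shell_strain y0 m Q x *v unit_normal y0 x = 0"
    unfolding shell_strain_def G G_axis_3 matrix_vector_mult_diff_rdistrib matrix_vector_mul_lid
      matrix_vector_mul_assoc[symmetric] inv append_column_axis_3 by simp
  show "bending_curvature y0 Q x *v unit_normal y0 x = 0"
    unfolding bending_curvature_def G matrix_vector_mul_assoc[symmetric] inv columns by simp
qed

theorem proposition4p1:
  fixes mu lam muc Lc b1 b2 b3 c1 C1 c2 h :: real
  assumes "mu > 0" "muc > 0" "2 * lam + mu > 0" "b1 > 0" "b2 > 0" "b3 > 0" "Lc > 0"
    and "c2 = smallest_eigenvalue (W_curv mu Lc b1 b2 b3)"
    and "c1 = smallest_eigenvalue (W_shell mu lam muc)"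
    and "C1 = largest_eigenvalue (W_shell mu lam muc)"
    and "h > 0"
  shows "\<exists>a1>0. \<forall>\<omega> y0.
    reference_configuration \<omega> h y0 \<longrightarrow>
    thickness_condition_i c2 C1 \<omega> h y0 \<or> thickness_condition_ii c1 C1 \<omega> h y0 \<longrightarrow>
    (\<forall>(m :: real^2 \<Rightarrow> real^3) (Q :: real^2 \<Rightarrow> real^3^3).
       (\<forall>x\<in>\<omega>. rotation_matrix (Q x)) \<longrightarrow>
       (\<forall>x\<in>\<omega>. has_partials_at m x \<and> has_partials_at Q x \<longrightarrow>
          W_h3 mu lam muc Lc b1 b2 b3 h y0 x (shell_strain y0 m Q x) (bending_curvature y0 Q x)
            \<ge> a1 * ((norm (shell_strain y0 m Q x))\<^sup>2 + (norm (bending_curvature y0 Q x))\<^sup>2)))"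
proof -
  have "c1 > 0" "c2 > 0"
    using assms W_shell_trace_coefficient_pos[of mu lam]
    by (auto simp: W_shell_isotropic W_curv_isotropic intro!: smallest_eigenvalue_isotropic_form_pos)
  have shell_lower: "c1 * (norm S)\<^sup>2 \<le> W_shell mu lam muc S"
    and shell_upper: "W_shell mu lam muc S \<le> C1 * (norm S)\<^sup>2"
    and curv_lower: "c2 * (norm S)\<^sup>2 \<le> W_curv mu Lc b1 b2 b3 S" for S
    unfolding assms(8-10) W_shell_isotropic W_curv_isotropic by (rule isotropic_form_bounds)+
  have "C1 > 0"
  proof -
    have "c1 * (norm (mat 1 :: real^3^3))\<^sup>2 \<le> C1 * (norm (mat 1 :: real^3^3))\<^sup>2"
      using shell_lower shell_upper by (rule order_trans)
    then show ?thesis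
      using \<open>c1 > 0\<close> by (simp add: power2_norm_eq_inner inner_vec_def mat_def sum_3)
  qed
  \<comment> \<open>The witness depends only on the coefficients and \<open>h\<close>, so it serves
    all surfaces and deformations at once.\<close>
  show ?thesis
  proof (intro exI[of _ "h / 2 * min c1 c2"] conjI allI impI ballI)
    show "h / 2 * min c1 c2 > 0"
      using \<open>c1 > 0\<close> \<open>c2 > 0\<close> \<open>h > 0\<close> by simp
    fix \<omega> y0 x and m :: "real^2 \<Rightarrow> real^3" and Q :: "real^2 \<Rightarrow> real^3^3"
    assume ref: "reference_configuration \<omega> h y0" and "x \<in> \<omega>"
      and rot: "\<forall>x\<in>\<omega>. rotation_matrix (Q x)"
      and cond: "thickness_condition_i c2 C1 \<omega> h y0 \<or> thickness_condition_ii c1 C1 \<omega> h y0"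
    let ?E = "shell_strain y0 m Q x" and ?K = "bending_curvature y0 Q x"
    have normal: "?E *v unit_normal y0 x = 0" "?K *v unit_normal y0 x = 0"
      using strain_normal[OF ref \<open>x \<in> \<omega>\<close>] rot \<open>x \<in> \<omega>\<close> by auto
    \<comment> \<open>With \<open>k = 1 / (a * h)\<close> the product \<open>h * k\<close> is
      \<open>1 / a\<close>; condition i) is the case \<open>a = 2\<close>.\<close>
    have shell: "curved_shell (B_tensor y0 x) (C_tensor y0 x) (unit_normal y0 x)
        (mean_curvature y0 x) (gauss_curvature y0 x) (1 / (a * h))"
      if "a > 0" "\<forall>x\<in>\<omega>. \<forall>\<kappa>\<in>principal_curvatures y0 x. h * \<bar>\<kappa>\<bar> < 1 / a" for a
    proof (rule reference_configuration_curved_shell[OF ref \<open>x \<in> \<omega>\<close>])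
      fix z assume "z \<in> principal_curvatures y0 x"
      with that(2) \<open>x \<in> \<omega>\<close> have "h * \<bar>z\<bar> < 1 / a"
        by blast
      then show "\<bar>z\<bar> \<le> 1 / (a * h)"
        using \<open>a > 0\<close> \<open>h > 0\<close> by (simp add: field_simps)
    qed
    \<comment> \<open>The final \<open>refl\<close> discharges \<open>F_def\<close> and so
      identifies \<open>F\<close> with \<open>E ** B + C ** K\<close>.\<close>
    note parameters = shell_lower shell_upper curv_lower \<open>c1 > 0\<close> \<open>c2 > 0\<close> \<open>h > 0\<close> normal refl
    from cond show "W_h3 mu lam muc Lc b1 b2 b3 h y0 x ?E ?K
        \<ge> h / 2 * min c1 c2 * ((norm ?E)\<^sup>2 + (norm ?K)\<^sup>2)"
    proof
      assume i: "thickness_condition_i c2 C1 \<omega> h y0"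
      then have "curved_shell (B_tensor y0 x) (C_tensor y0 x) (unit_normal y0 x)
          (mean_curvature y0 x) (gauss_curvature y0 x) (1 / (2 * h))"
        by (intro shell) (auto simp: thickness_condition_i_def)
      moreover have "h * (1 / (2 * h)) \<le> 1 / 2"
        using \<open>h > 0\<close> by simp
      moreover have "h\<^sup>2 * C1 \<le> (47/4)\<^sup>2 * (5 - 2 * sqrt 6) * c2"
        using i \<open>C1 > 0\<close> unfolding thickness_condition_i_def
        by (metis less_imp_le pos_less_divide_eq times_divide_eq_right)
      ultimately show ?thesis
        unfolding W_h3_def Let_def
        by (rule curved_shell.coercive_small_thickness[OF _ parameters])
    next
      assume "thickness_condition_ii c1 C1 \<omega> h y0"
      then obtain a where a: "a > 1 + sqrt 2 / 2" "a > (1 + sqrt (1 + 3 * (C1 / c1))) / 2"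
        and curvatures: "\<forall>x\<in>\<omega>. \<forall>\<kappa>\<in>principal_curvatures y0 x. h * \<bar>\<kappa>\<bar> < 1 / a"
        unfolding thickness_condition_ii_def by auto
      have "a > 1"
        using a(1) by (smt (verit) divide_pos_pos real_sqrt_gt_zero)
      then have "curved_shell (B_tensor y0 x) (C_tensor y0 x) (unit_normal y0 x)
          (mean_curvature y0 x) (gauss_curvature y0 x) (1 / (a * h))"
        using curvatures by (intro shell) auto
      moreover have "h * (1 / (a * h)) \<le> 1 / a" "a \<ge> 1"
        using \<open>h > 0\<close> \<open>a > 1\<close> by auto
      moreover have "4 * a\<^sup>2 - 4 * a \<ge> 3 * (C1 / c1)"
      proof -
        \<comment> \<open>The second lower bound on \<open>a\<close> says that
          \<open>2 * a - 1\<close> exceeds the square root of the left side.\<close>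
        have "1 + 3 * (C1 / c1) \<le> (2 * a - 1)\<^sup>2"
          using a(2) by (intro sqrt_le_D) simp
        then show ?thesis
          by (simp add: power2_eq_square algebra_simps)
      qed
      ultimately show ?thesis
        unfolding W_h3_def Let_def
        by (rule curved_shell.coercive_small_curvature[OF _ parameters])
    qed
  qed
qed

end
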